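(* Let $d=2s+1$ and $r=\binom{n+s}{s}$. Then a general $[F]\in\sigma_r(\nu_d(\mathbb{P}^n))$ is border identifiable, i.e. $\underline{\mathrm{VSP}}(F,\underline{\mathbf{rk}}(F))$ is a single point.
   Context: Here $n\geq 1$ and $s\geq 0$ are integers. $S=\mathbb{C}[y_0,\dots,y_n]$ and $T=\mathbb{C}[x_0,\dots,x_n]$ are standard graded, $S$ acting on $T$ by differentiation ($y_i\circ x_j=\delta_{ij}$); $\nu_d(\mathbb{P}^n)\subset\mathbb{P}(T_d)$ is the $d$-th Veronese variety and $\sigma_r$ denotes its $r$-th secant variety (closure of the union of linear spans of $r$ points). The border rank $\underline{\mathbf{rk}}(F)$ of $F\in T_d$ is the least $k$ with $[F]\in\sigma_k(\nu_d(\mathbb{P}^n))$. "General" means: in some dense Zariski open subset. $\mathrm{Ann}(F)=\{\psi\in S:\psi\circ F=0\}$. $h_{r,\mathbb{P}^n}(k)=\min\{r,\dim_{\mathbb C}S_k\}$; $\mathrm{Hilb}_S^{h_{r,\mathbb{P}^n}}$ is the multigraded (Haiman–Sturmfels) Hilbert scheme of homogeneous ideals $I\subset S$ such that $S/I$ has Hilbert function $h_{r,\mathbb{P}^n}$; $\mathrm{Slip}_{r,\mathbb{P}^n}$ is its irreducible component that is the closure of the locus of saturated ideals of $r$ distinct points with Hilbert function $h_{r,\mathbb{P}^n}$. $\underline{\mathrm{VSP}}(F,r)=\{J\in\mathrm{Slip}_{r,\mathbb{P}^n}:J\subset\mathrm{Ann}(F)\}$. *)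

theory Defs
  imports
    "HOL-Library.Cardinality"
    "HOL-Library.Poly_Mapping"
    "HOL-Analysis.Function_Topology"
    "Jordan_Normal_Form.Determinant"
begin

section \<open>Polynomials\<close>

text \<open>
  A finite type \<open>'v\<close> with \<open>n + 1\<close> elements indexes the variables.  The rings
  \<open>S = \<complex>[y\<^sub>0, \<dots>, y\<^sub>n]\<close> and \<open>T = \<complex>[x\<^sub>0, \<dots>, x\<^sub>n]\<close> are both represented by the type
  \<open>'v cpoly\<close>.  The same type constructor, with other (possibly infinite) variable types, is used
  for the polynomials in homogeneous coordinates that define the Zariski topologies below.
\<close>

type_synonym 'x monom = "'x \<Rightarrow>\<^sub>0 nat"
type_synonym 'x cpoly = "'x monom \<Rightarrow>\<^sub>0 complex"

definition mdeg :: "'x monom \<Rightarrow> nat" where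
  "mdeg m = (\<Sum>x\<in>Poly_Mapping.keys m. Poly_Mapping.lookup m x)"

definition forms :: "nat \<Rightarrow> 'x cpoly set" where
  "forms k = {p. \<forall>m\<in>Poly_Mapping.keys p. mdeg m = k}"

definition hom_component :: "nat \<Rightarrow> 'x cpoly \<Rightarrow> 'x cpoly" where
  "hom_component k p =
     (\<Sum>m\<in>{m \<in> Poly_Mapping.keys p. mdeg m = k}. Poly_Mapping.single m (Poly_Mapping.lookup p m))"

definition poly_eval :: "('x \<Rightarrow> complex) \<Rightarrow> 'x cpoly \<Rightarrow> complex" where
  "poly_eval a p =
     (\<Sum>m\<in>Poly_Mapping.keys p. Poly_Mapping.lookup p m *
        (\<Prod>x\<in>Poly_Mapping.keys m. a x ^ Poly_Mapping.lookup m x))"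

definition cscale :: "complex \<Rightarrow> 'x cpoly \<Rightarrow> 'x cpoly" where
  "cscale c p = Poly_Mapping.single 0 c * p"

global_interpretation cpoly: vector_space "cscale :: complex \<Rightarrow> 'x cpoly \<Rightarrow> 'x cpoly"
  by unfold_locales
    (simp_all add: cscale_def algebra_simps single_add mult_single flip: mult.assoc)


section \<open>Apolarity\<close>

text \<open>
  \<open>\<psi> \<circ> F\<close> for \<open>\<psi> \<in> S\<close> acting as a differential operator on \<open>F \<in> T\<close>: bilinear extension of
  \<open>y\<^sup>a \<circ> x\<^sup>b = (\<Prod>i. b\<^sub>i (b\<^sub>i - 1) \<dots> (b\<^sub>i - a\<^sub>i + 1)) x\<^bsup>b - a\<^esup>\<close>.  The subtraction is truncated, so
  the coefficient vanishes as soon as some \<open>a\<^sub>i > b\<^sub>i\<close>.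
\<close>

definition apolar :: "'v::finite cpoly \<Rightarrow> 'v cpoly \<Rightarrow> 'v cpoly" where
  "apolar \<psi> F =
     (\<Sum>a\<in>Poly_Mapping.keys \<psi>. \<Sum>b\<in>Poly_Mapping.keys F.
        Poly_Mapping.single (b - a)
          (Poly_Mapping.lookup \<psi> a * Poly_Mapping.lookup F b *
           of_nat (\<Prod>i\<in>UNIV. \<Prod>j<Poly_Mapping.lookup a i. Poly_Mapping.lookup b i - j)))"

definition Ann :: "'v::finite cpoly \<Rightarrow> 'v cpoly set" where
  "Ann F = {\<psi>. apolar \<psi> F = 0}"


section \<open>Projective spaces of forms, Veronese and secant varieties\<close>

text \<open>
  Points of \<open>\<P>(T\<^sub>d)\<close> are lines through the origin in \<open>T\<^sub>d\<close>; \<open>pt F\<close> is the point \<open>[F]\<close> when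
  \<open>F \<noteq> 0\<close>.  Projective \<open>n\<close>-space is \<open>\<P>(T\<^sub>1)\<close>.
\<close>

definition pt :: "'v::finite cpoly \<Rightarrow> 'v cpoly set" where
  "pt F = cpoly.span {F}"

definition proj_forms :: "nat \<Rightarrow> 'v::finite cpoly set set" where
  "proj_forms d = pt ` (forms d - {0})"

text \<open>
  The basic open sets are the complements of hypersurfaces.  The homogeneous coordinates of \<open>[F]\<close>
  are the coefficients of \<open>F\<close>, so the equations \<open>f\<close> have the monomials as variables (those of
  degree other than \<open>d\<close> take the value 0 on \<open>T\<^sub>d\<close>).
\<close>

definition proj_zariski :: "nat \<Rightarrow> 'v::finite cpoly set topology" where
  "proj_zariski d = topology_generated_by
     {pt ` {F \<in> forms d - {0}. poly_eval (Poly_Mapping.lookup F) f \<noteq> 0}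
       | f :: 'v monom cpoly. \<exists>e. f \<in> forms e}"

definition veronese :: "nat \<Rightarrow> 'v::finite cpoly set set" where
  "veronese d = {pt (l ^ d) | l. l \<in> forms 1 - {0}}"

definition secant_variety :: "nat \<Rightarrow> nat \<Rightarrow> 'v::finite cpoly set set" where
  "secant_variety r d = proj_zariski d closure_of
     {p \<in> proj_forms d. \<exists>A \<subseteq> veronese d. finite A \<and> card A \<le> r \<and> p \<subseteq> cpoly.span (\<Union>A)}"

definition border_rank :: "nat \<Rightarrow> 'v::finite cpoly \<Rightarrow> nat" where
  "border_rank d F = (LEAST k. pt F \<in> secant_variety k d)"

definition holds_generally :: "'a topology \<Rightarrow> 'a set \<Rightarrow> ('a \<Rightarrow> bool) \<Rightarrow> bool" where
  "holds_generally X V P \<longleftrightarrow>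
     (\<exists>U. openin (subtopology X V) U \<and> subtopology X V closure_of U = V \<and> (\<forall>p\<in>U. P p))"


section \<open>The multigraded Hilbert scheme and its Slip component\<close>

definition homogeneous_ideal :: "'v::finite cpoly set \<Rightarrow> bool" where
  "homogeneous_ideal I \<longleftrightarrow>
     module.subspace (*) I \<and> (\<forall>p\<in>I. \<forall>k. hom_component k p \<in> I)"

text \<open>The dimension of \<open>(S/I)\<^sub>k = S\<^sub>k / I\<^sub>k\<close>.\<close>

definition hilbert_function :: "'v::finite cpoly set \<Rightarrow> nat \<Rightarrow> nat" where
  "hilbert_function I k =
     cpoly.dim (forms k :: 'v cpoly set) - cpoly.dim (I \<inter> forms k)"

definition hilb :: "nat \<Rightarrow> 'v::finite cpoly set set" where
  "hilb r = {I. homogeneous_ideal I \<and>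
     (\<forall>k. hilbert_function I k = min r (cpoly.dim (forms k :: 'v cpoly set)))}"

text \<open>
  The Zariski topology on (the closed points of) the multigraded Hilbert scheme is induced by its
  embedding \<open>I \<mapsto> (I\<^sub>k)\<^sub>k\<close> into a product of Grassmannians \<open>Gr(S\<^sub>k)\<close>, each of which carries its
  Pluecker embedding.  Haiman and Sturmfels show that finitely many large enough sets of degrees
  suffice for a closed embedding; since enlarging the set of degrees does not change the induced
  topology, all degrees are used here (each equation involves only finitely many of them).

  The variable \<open>(k, \<mu>)\<close> stands for the Pluecker coordinate of \<open>I\<^sub>k\<close> at the monomials
  \<open>\<mu> 0, \<mu> 1, \<dots>\<close>, that is, the maximal minor in these columns of the coefficient matrix of a basis of
  \<open>I\<^sub>k\<close>.  Equations are homogeneous in the coordinates of each factor, so that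
  non-vanishing does not depend on the bases.
\<close>

definition is_basis :: "'v::finite cpoly list \<Rightarrow> 'v cpoly set \<Rightarrow> bool" where
  "is_basis bs V \<longleftrightarrow> distinct bs \<and> cpoly.independent (set bs) \<and> cpoly.span (set bs) = V"

definition plucker :: "'v::finite cpoly list \<Rightarrow> (nat \<Rightarrow> 'v monom) \<Rightarrow> complex" where
  "plucker bs \<mu> =
     det (mat (length bs) (length bs) (\<lambda>(i, j). Poly_Mapping.lookup (bs ! i) (\<mu> j)))"

definition multihomogeneous :: "(nat \<times> 'y) cpoly \<Rightarrow> bool" where
  "multihomogeneous f \<longleftrightarrow>
     (\<exists>e. \<forall>m\<in>Poly_Mapping.keys f. \<forall>k.
        (\<Sum>x\<in>{x \<in> Poly_Mapping.keys m. fst x = k}. Poly_Mapping.lookup m x) = e k)"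

definition hilb_zariski :: "nat \<Rightarrow> 'v::finite cpoly set topology" where
  "hilb_zariski r = topology_generated_by
     {{I \<in> hilb r. \<exists>b. (\<forall>k. is_basis (b k) (I \<inter> forms k)) \<and>
                        poly_eval (\<lambda>(k, \<mu>). plucker (b k) \<mu>) f \<noteq> 0}
       | f :: (nat \<times> (nat \<Rightarrow> 'v monom)) cpoly. multihomogeneous f}"

text \<open>
  The homogeneous ideal of a set of points of \<open>\<P>(T\<^sub>1)\<close>.  The affine coordinates of
  \<open>l = \<Sum>i. a\<^sub>i x\<^sub>i\<close> are its coefficients, and all representatives \<open>l\<close> of each point are tested, so
  every homogeneous component of a member vanishes on \<open>\<Gamma>\<close>.  Being an ideal of a reduced set of
  points it is saturated.
\<close>

definition vanishing_ideal :: "'v::finite cpoly set set \<Rightarrow> 'v cpoly set" where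
  "vanishing_ideal \<Gamma> =
     {f. \<forall>p\<in>\<Gamma>. \<forall>l\<in>p. poly_eval (\<lambda>i. Poly_Mapping.lookup l (Poly_Mapping.single i 1)) f = 0}"

definition slip :: "nat \<Rightarrow> 'v::finite cpoly set set" where
  "slip r = hilb_zariski r closure_of
     {I \<in> hilb r. \<exists>\<Gamma> \<subseteq> proj_forms 1. finite \<Gamma> \<and> card \<Gamma> = r \<and> I = vanishing_ideal \<Gamma>}"

definition border_vsp :: "'v::finite cpoly \<Rightarrow> nat \<Rightarrow> 'v cpoly set set" where
  "border_vsp F r = {J \<in> slip r. J \<subseteq> Ann F}"

definition border_identifiable :: "nat \<Rightarrow> 'v::finite cpoly \<Rightarrow> bool" where
  "border_identifiable d F \<longleftrightarrow> is_singleton (border_vsp F (border_rank d F))"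

end

theory Submission
  imports Defs "HOL-Computational_Algebra.Polynomial"
begin

text \<open>
  Fix a variable \<open>z\<close> and call \<open>disc F\<close> the discriminant of the quadratic form
  \<open>q \<mapsto> (z q\<^sup>2) \<circ> F\<close> on the forms of degree \<open>s\<close>.  The open set is \<open>disc F \<noteq> 0\<close>.  There the
  relations \<open>W\<close>, the forms of degree \<open>s + 1\<close> in \<open>Ann F\<close>, are a complement of \<open>z S\<^sub>s\<close>, so multiplication by
  \<open>z\<close> is onto in \<open>S/(W)\<close> from degree \<open>s\<close> on and \<open>(W)\<close> has codimension at most \<open>r\<close> in every
  degree.  An ideal in \<open>Ann F\<close> with the generic Hilbert function contains \<open>W\<close> for dimension reasons,
  hence equals \<open>(W)\<close>: this is uniqueness.  Cramer's rule gives explicit generators of \<open>(W)\<close> in each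
  degree whose coefficients are polynomials in those of \<open>F\<close>.  If \<open>F\<close> is a sum of \<open>r\<close> powers
  of linear forms, \<open>(W)\<close> is the ideal of the corresponding points; the polynomial dependence on
  \<open>F\<close> carries both the Hilbert function and membership in the Slip component over to the closure.
\<close>

section \<open>Polynomials as finitely supported functions\<close>

text \<open>In degree \<open>2 * s + 1\<close> the usual catalecticant pairs forms of degree s with
  forms of degree s + 1 and is not square. Spending one degree on z leaves a symmetric matrix whose
  size is dim S_s, and this is where r comes from. For a sum of r terms \<open>c j * l j ^ d\<close>
  its determinant splits into the square of an interpolation determinant, the \<open>c j\<close> and
  the z-coordinates of the \<open>l j\<close>: it detects independent points, genuine summands and
  points off the hyperplane z = 0 all at once. The obstacle: a nonzero discriminant bounds the
  codimension of (W) only from above. A general plane cubic (s = 1) satisfies it, yet its W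
  generates an ideal of codimension 1 instead of 3 in degree 3. Membership in the secant variety
  must therefore enter through equations. Each graded piece is written as a span with explicit
  pivots, of the right dimension whenever the discriminant is nonzero, and the failure of these
  spans to form an ideal is measured by remainders. The constructions never divide by the
  discriminant, so everything stays polynomial in the coefficients of F, and closure arguments
  reduce to the non-vanishing of one polynomial at some power sum.\<close>

abbreviation (input) lookup where "lookup \<equiv> Poly_Mapping.lookup"
abbreviation (input) single where "single \<equiv> Poly_Mapping.single"
abbreviation (input) keys where "keys \<equiv> Poly_Mapping.keys"

lemma poly_mapping_sum_single:
  fixes p :: "'a \<Rightarrow>\<^sub>0 'b::comm_monoid_add"
  assumes "finite A" "keys p \<subseteq> A"
  shows "p = (\<Sum>m\<in>A. single m (lookup p m))"
proof (rule poly_mapping_eqI)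
  fix k
  have "lookup (\<Sum>m\<in>A. single m (lookup p m)) k = (\<Sum>m\<in>A. if m = k then lookup p m else 0)"
    by (simp add: lookup_sum lookup_single when_def)
  also have "\<dots> = lookup p k"
    using assms by (auto simp: in_keys_iff)
  finally show "lookup p k = lookup (\<Sum>m\<in>A. single m (lookup p m)) k" by simp
qed

lemma poly_mapping_additive_induct [case_names zero single add]:
  fixes p :: "'a \<Rightarrow>\<^sub>0 'b::comm_monoid_add"
  assumes "P 0" "\<And>m c. P (single m c)" "\<And>p q. P p \<Longrightarrow> P q \<Longrightarrow> P (p + q)"
  shows "P p"
proof -
  have "P (\<Sum>m\<in>A. single m (lookup p m))" if "finite A" for A
    using that by induction (auto intro: assms)
  from this[of "keys p"] show ?thesis
    using poly_mapping_sum_single[of "keys p" p] by simp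
qed

lemma lookup_single_mult:
  fixes p :: "('a \<Rightarrow>\<^sub>0 nat) \<Rightarrow>\<^sub>0 complex"
  shows "lookup (single a c * p) m = (if \<exists>b. m = a + b then c * lookup p (m - a) else 0)"
proof (induction p rule: poly_mapping_additive_induct)
  case (single n e)
  have "a + n = m \<longleftrightarrow> (\<exists>b. m = a + b) \<and> n = m - a" by auto
  then show ?case by (auto simp: mult_single lookup_single when_def)
next
  case (add p q)
  then show ?case by (simp add: distrib_left lookup_add)
qed simp

lemma lookup_single_mult_add [simp]:
  fixes p :: "('a \<Rightarrow>\<^sub>0 nat) \<Rightarrow>\<^sub>0 complex"
  shows "lookup (single a c * p) (a + b) = c * lookup p b"
  by (auto simp: lookup_single_mult)

lemma lookup_cscale [simp]: "lookup (cscale c p) m = c * lookup p m"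
  using lookup_single_mult_add[of 0 c p m] by (simp add: cscale_def)

lemma cscale_single [simp]: "cscale c (single m b) = single m (c * b)"
  by (simp add: cscale_def mult_single)

lemma cscale_mult_left: "cscale c p * q = cscale c (p * q)"
  by (simp add: cscale_def mult.assoc)

lemma cscale_mult_right: "p * cscale c q = cscale c (p * q)"
  by (simp add: cscale_def mult_ac)

lemma keys_cscale_subset: "keys (cscale c p) \<subseteq> keys p"
  by (auto simp: in_keys_iff)

section \<open>Evaluation of monomials and polynomials\<close>

definition mono_eval :: "('x \<Rightarrow> complex) \<Rightarrow> 'x monom \<Rightarrow> complex" where
  "mono_eval a m = (\<Prod>x\<in>keys m. a x ^ lookup m x)"

lemma mono_eval_superset:
  "finite A \<Longrightarrow> keys m \<subseteq> A \<Longrightarrow> mono_eval a m = (\<Prod>x\<in>A. a x ^ lookup m x)"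
  unfolding mono_eval_def by (rule prod.mono_neutral_left) (auto simp: in_keys_iff)

lemma mono_eval_add: "mono_eval a (m + n) = mono_eval a m * mono_eval a n"
  using mono_eval_superset[of "keys m \<union> keys n" "m + n" a]
    mono_eval_superset[of "keys m \<union> keys n" m a] mono_eval_superset[of "keys m \<union> keys n" n a]
    Poly_Mapping.keys_add[of m n]
  by (simp add: lookup_add power_add prod.distrib)

lemma mono_eval_zero [simp]: "mono_eval a 0 = 1"
  by (simp add: mono_eval_def)

lemma mono_eval_single [simp]: "mono_eval a (single x k) = a x ^ k"
  by (simp add: mono_eval_def)

lemma poly_eval_superset:
  "finite A \<Longrightarrow> keys p \<subseteq> A \<Longrightarrow> poly_eval a p = (\<Sum>m\<in>A. lookup p m * mono_eval a m)"
  unfolding poly_eval_def mono_eval_def by (rule sum.mono_neutral_left) (auto simp: in_keys_iff)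

lemma poly_eval_zero [simp]: "poly_eval a 0 = 0"
  by (simp add: poly_eval_def)

lemma poly_eval_single [simp]: "poly_eval a (single m c) = c * mono_eval a m"
  by (simp add: poly_eval_def mono_eval_def)

lemma poly_eval_one [simp]: "poly_eval a 1 = 1"
  using poly_eval_single[of a 0 1] by simp

lemma poly_eval_add: "poly_eval a (p + q) = poly_eval a p + poly_eval a q"
  using poly_eval_superset[of "keys p \<union> keys q" "p + q" a]
    poly_eval_superset[of "keys p \<union> keys q" p a] poly_eval_superset[of "keys p \<union> keys q" q a]
    Poly_Mapping.keys_add[of p q]
  by (simp add: lookup_add distrib_right sum.distrib)

lemma poly_eval_sum: "poly_eval a (\<Sum>i\<in>A. f i) = (\<Sum>i\<in>A. poly_eval a (f i))"
  by (induction A rule: infinite_finite_induct) (auto simp: poly_eval_add)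

lemma poly_eval_mult: "poly_eval a (p * q) = poly_eval a p * poly_eval a q"
proof (induction p rule: poly_mapping_additive_induct)
  case (single m c)
  show ?case
    by (induction q rule: poly_mapping_additive_induct)
      (auto simp: mult_single mono_eval_add distrib_left poly_eval_add)
qed (auto simp: distrib_right poly_eval_add)

lemma poly_eval_prod: "poly_eval a (\<Prod>i\<in>A. f i) = (\<Prod>i\<in>A. poly_eval a (f i))"
  by (induction A rule: infinite_finite_induct) (auto simp: poly_eval_mult)

lemma poly_eval_cscale: "poly_eval a (cscale c p) = c * poly_eval a p"
  by (simp add: cscale_def poly_eval_mult)

lemma poly_eval_diff: "poly_eval a (p - q) = poly_eval a p - poly_eval a q"
  using poly_eval_add[of a "p - q" q] by simp

section \<open>Degrees and homogeneous components\<close>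

lemma mdeg_superset:
  "finite A \<Longrightarrow> keys m \<subseteq> A \<Longrightarrow> mdeg m = (\<Sum>x\<in>A. lookup m x)"
  unfolding mdeg_def by (rule sum.mono_neutral_left) (auto simp: in_keys_iff)

lemma mdeg_finite: "mdeg (m :: 'v::finite monom) = (\<Sum>x\<in>UNIV. lookup m x)"
  by (rule mdeg_superset) auto

lemma mdeg_add: "mdeg (m + n) = mdeg m + mdeg n"
  using mdeg_superset[of "keys m \<union> keys n" "m + n"]
    mdeg_superset[of "keys m \<union> keys n" m] mdeg_superset[of "keys m \<union> keys n" n]
    Poly_Mapping.keys_add[of m n]
  by (simp add: lookup_add sum.distrib)

lemma mdeg_zero [simp]: "mdeg 0 = 0"
  by (simp add: mdeg_def)

lemma mdeg_single [simp]: "mdeg (single x k) = k"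
  by (simp add: mdeg_def)

lemma mdeg_eq_0_iff [simp]: "mdeg m = 0 \<longleftrightarrow> m = 0"
proof
  assume "mdeg m = 0"
  then have "\<forall>x\<in>keys m. lookup m x = 0" by (simp add: mdeg_def)
  then show "m = 0" by (metis in_keys_iff keys_eq_empty ex_in_conv)
qed simp

lemma mono_eval_scale: "mono_eval (\<lambda>x. t * a x) m = t ^ mdeg m * mono_eval a m"
  by (simp add: mono_eval_def mdeg_def power_mult_distrib prod.distrib power_sum)

lemma forms_zero [simp]: "0 \<in> forms k"
  by (simp add: forms_def)

lemma forms_lookup: "p \<in> forms k \<longleftrightarrow> (\<forall>m. mdeg m \<noteq> k \<longrightarrow> lookup p m = 0)"
  by (auto simp: forms_def in_keys_iff)

lemma forms_single: "mdeg m = k \<Longrightarrow> single m c \<in> forms k"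
  by (auto simp: forms_lookup lookup_single when_def)

lemma forms_subspace: "cpoly.subspace (forms k)"
  by (rule cpoly.subspaceI) (auto simp: forms_lookup lookup_add)

lemma forms_mult:
  assumes "p \<in> forms k" "q \<in> forms l"
  shows "p * q \<in> forms (k + l)"
proof -
  have "p * q = (\<Sum>m\<in>keys p. single m (lookup p m)) * (\<Sum>n\<in>keys q. single n (lookup q n))"
    using poly_mapping_sum_single[of "keys p" p] poly_mapping_sum_single[of "keys q" q] by simp
  also have "\<dots> = (\<Sum>m\<in>keys p. \<Sum>n\<in>keys q. single (m + n) (lookup p m * lookup q n))"
    by (simp add: sum_product mult_single)
  also have "\<dots> \<in> forms (k + l)"
    using assms by (intro cpoly.subspace_sum[OF forms_subspace] forms_single)
      (auto simp: forms_def mdeg_add)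
  finally show ?thesis .
qed

lemma forms_one: "1 \<in> forms 0"
  using forms_single[of 0 0 1] by simp

lemma forms_prod:
  "(\<And>i. i \<in> A \<Longrightarrow> f i \<in> forms (e i)) \<Longrightarrow> (\<Prod>i\<in>A. f i) \<in> forms (\<Sum>i\<in>A. e i)"
  by (induction A rule: infinite_finite_induct) (auto simp: forms_one intro!: forms_mult)

lemma forms_power: "p \<in> forms k \<Longrightarrow> p ^ e \<in> forms (e * k)"
  by (induction e) (auto simp: forms_one intro!: forms_mult)

lemma poly_eval_forms_scale:
  assumes "p \<in> forms k"
  shows "poly_eval (\<lambda>x. t * a x) p = t ^ k * poly_eval a p"
  using assms unfolding poly_eval_superset[OF finite_keys order_refl]
  by (auto simp: mono_eval_scale sum_distrib_left forms_def intro!: sum.cong)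

lemma lookup_hom_component: "lookup (hom_component k p) m = (if mdeg m = k then lookup p m else 0)"
proof -
  have "lookup (hom_component k p) m
      = (\<Sum>n\<in>{n \<in> keys p. mdeg n = k}. if n = m then lookup p n else 0)"
    by (simp add: hom_component_def lookup_sum lookup_single when_def)
  also have "\<dots> = (if mdeg m = k then lookup p m else 0)"
    by (auto simp: in_keys_iff)
  finally show ?thesis .
qed

lemma hom_component_in_forms: "hom_component k p \<in> forms k"
  by (simp add: forms_lookup lookup_hom_component)

lemma hom_component_zero [simp]: "hom_component k 0 = 0"
  by (rule poly_mapping_eqI) (simp add: lookup_hom_component)

lemma hom_component_add: "hom_component k (p + q) = hom_component k p + hom_component k q"
  by (rule poly_mapping_eqI) (simp add: lookup_hom_component lookup_add)

lemma hom_component_forms: "p \<in> forms l \<Longrightarrow> hom_component k p = (if k = l then p else 0)"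
  by (rule poly_mapping_eqI) (auto simp: lookup_hom_component forms_lookup)

lemma hom_component_single_mult:
  "hom_component k (single m c * p)
     = (if mdeg m \<le> k then single m c * hom_component (k - mdeg m) p else 0)"
  by (rule poly_mapping_eqI) (auto simp: lookup_hom_component lookup_single_mult mdeg_add)

lemma sum_hom_components: "p = (\<Sum>k\<in>mdeg ` keys p. hom_component k p)"
proof (rule poly_mapping_eqI)
  fix m
  have "lookup (\<Sum>k\<in>mdeg ` keys p. hom_component k p) m
      = (\<Sum>k\<in>mdeg ` keys p. if k = mdeg m then lookup p m else 0)"
    by (auto simp: lookup_sum lookup_hom_component intro!: sum.cong)
  also have "\<dots> = lookup p m" by (auto simp: in_keys_iff)
  finally show "lookup p m = lookup (\<Sum>k\<in>mdeg ` keys p. hom_component k p) m" by simp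
qed


section \<open>Polynomial functions of one variable\<close>

text \<open>Restriction to a line in parameter space: a nonzero polynomial in one variable has
  finitely many zeros, and this takes the place of irreducibility in the density argument.\<close>

definition polyfun :: "(complex \<Rightarrow> complex) \<Rightarrow> bool" where
  "polyfun g \<longleftrightarrow> (\<exists>p. \<forall>t. g t = poly p t)"

lemma polyfun_const: "polyfun (\<lambda>t. c)"
  unfolding polyfun_def by (rule exI[of _ "[:c:]"]) simp

lemma polyfun_add: "polyfun f \<Longrightarrow> polyfun g \<Longrightarrow> polyfun (\<lambda>t. f t + g t)"
  unfolding polyfun_def by (metis poly_add)

lemma polyfun_mult: "polyfun f \<Longrightarrow> polyfun g \<Longrightarrow> polyfun (\<lambda>t. f t * g t)"
  unfolding polyfun_def by (metis poly_mult)

lemma polyfun_sum: "(\<And>i. i \<in> A \<Longrightarrow> polyfun (f i)) \<Longrightarrow> polyfun (\<lambda>t. \<Sum>i\<in>A. f i t)"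
  by (induction A rule: infinite_finite_induct) (auto intro: polyfun_const polyfun_add)

lemma polyfun_prod: "(\<And>i. i \<in> A \<Longrightarrow> polyfun (f i)) \<Longrightarrow> polyfun (\<lambda>t. \<Prod>i\<in>A. f i t)"
  by (induction A rule: infinite_finite_induct) (auto intro: polyfun_const polyfun_mult)

lemma polyfun_power: "polyfun f \<Longrightarrow> polyfun (\<lambda>t. f t ^ k)"
  by (induction k) (auto intro: polyfun_const polyfun_mult)

lemma polyfun_poly_eval: "(\<And>x. polyfun (\<lambda>t. a t x)) \<Longrightarrow> polyfun (\<lambda>t. poly_eval (a t) p)"
  unfolding poly_eval_def
  by (intro polyfun_sum polyfun_mult polyfun_prod polyfun_power polyfun_const)

lemma polyfun_nonzero:
  assumes "polyfun f" "f a \<noteq> 0" "finite S"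
  shows "\<exists>t. t \<notin> S \<and> f t \<noteq> 0"
proof -
  from assms(1) obtain p where p: "\<And>t. f t = poly p t" by (auto simp: polyfun_def)
  with assms(2) have "p \<noteq> 0" by auto
  then have "finite ({t. poly p t = 0} \<union> S)" using assms(3) by (simp add: poly_roots_finite)
  then have "{t. poly p t = 0} \<union> S \<noteq> UNIV" using infinite_UNIV_char_0 by metis
  then show ?thesis using p by auto
qed

text \<open>Along the line through \<open>a\<close>, \<open>p\<close> becomes a polynomial in t
  whose coefficient at \<open>t ^ e\<close> is the value of the component of degree e. Hence
  inhomogeneous equations can be used on projective points, at the price of rescaling the
  representative.\<close>

lemma poly_eval_scaled_nonzero:
  assumes "poly_eval a (hom_component e p) \<noteq> 0"
  shows "\<exists>t. t \<noteq> 0 \<and> poly_eval (\<lambda>x. t * a x) p \<noteq> 0"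
proof -
  define P where "P = (\<Sum>m\<in>keys p. Polynomial.monom (lookup p m * mono_eval a m) (mdeg m))"
  have poly_P: "poly P t = poly_eval (\<lambda>x. t * a x) p" for t
    by (simp add: P_def poly_eval_superset[OF finite_keys order_refl] poly_sum
        Polynomial.poly_monom mono_eval_scale mult_ac)
  have "Polynomial.coeff P e
      = (\<Sum>m\<in>keys p. if mdeg m = e then lookup p m * mono_eval a m else 0)"
    by (simp add: P_def Polynomial.coeff_sum)
  also have "\<dots> = poly_eval a (hom_component e p)"
    by (subst poly_eval_superset[of "keys p"])
      (auto simp: lookup_hom_component in_keys_iff intro!: sum.cong split: if_splits)
  finally have "P \<noteq> 0" using assms by auto
  then obtain b where "poly P b \<noteq> 0" using poly_all_0_iff_0 by blast
  then have "\<exists>t. t \<notin> {0} \<and> poly P t \<noteq> 0"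
    by (intro polyfun_nonzero) (auto simp: polyfun_def)
  then show ?thesis by (auto simp: poly_P)
qed


section \<open>Regular functions of the coefficients of a form\<close>

definition regular :: "('v cpoly \<Rightarrow> complex) \<Rightarrow> bool" where
  "regular g \<longleftrightarrow> (\<exists>f. \<forall>F. g F = poly_eval (lookup F) f)"

lemma regular_const: "regular (\<lambda>F. c)"
  unfolding regular_def by (rule exI[of _ "single 0 c"]) simp

lemma regular_lookup: "regular (\<lambda>F. lookup F m)"
  unfolding regular_def by (rule exI[of _ "single (single m 1) 1"]) simp

lemma regular_add: "regular f \<Longrightarrow> regular g \<Longrightarrow> regular (\<lambda>F. f F + g F)"
  unfolding regular_def by (metis poly_eval_add)

lemma regular_mult: "regular f \<Longrightarrow> regular g \<Longrightarrow> regular (\<lambda>F. f F * g F)"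
  unfolding regular_def by (metis poly_eval_mult)

lemma regular_diff: "regular f \<Longrightarrow> regular g \<Longrightarrow> regular (\<lambda>F. f F - g F)"
  unfolding regular_def by (metis poly_eval_diff)

lemma regular_sum: "(\<And>i. i \<in> A \<Longrightarrow> regular (f i)) \<Longrightarrow> regular (\<lambda>F. \<Sum>i\<in>A. f i F)"
  by (induction A rule: infinite_finite_induct) (auto intro: regular_const regular_add)

lemma regular_prod: "(\<And>i. i \<in> A \<Longrightarrow> regular (f i)) \<Longrightarrow> regular (\<lambda>F. \<Prod>i\<in>A. f i F)"
  by (induction A rule: infinite_finite_induct) (auto intro: regular_const regular_mult)

lemma regular_power: "regular f \<Longrightarrow> regular (\<lambda>F. f F ^ k)"
  by (induction k) (auto intro: regular_const regular_mult)

lemma regular_poly_eval: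
  "(\<And>x. regular (\<lambda>F. a F x)) \<Longrightarrow> regular (\<lambda>F. poly_eval (a F) p)"
  unfolding poly_eval_def
  by (intro regular_sum regular_mult regular_prod regular_power regular_const)

lemma regular_det:
  assumes "\<And>i j. i < n \<Longrightarrow> j < n \<Longrightarrow> regular (\<lambda>F. e F i j)"
  shows "regular (\<lambda>F. det (mat n n (\<lambda>(i, j). e F i j)))"
proof -
  have "det (mat n n (\<lambda>(i, j). e F i j))
      = (\<Sum>p\<in>{p. p permutes {0..<n}}. signof p * (\<Prod>i=0..<n. e F i (p i)))" for F
    unfolding det_def
    by (auto intro!: sum.cong prod.cong arg_cong2[where f = "(*)"] simp: permutes_in_image)
  moreover have "regular (\<lambda>F. e F i (p i))" if "p permutes {0..<n}" "i \<in> {0..<n}" for p i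
    using assms[of i "p i"] that permutes_in_image[of p "{0..<n}" i] by auto
  ultimately show ?thesis
    by (auto intro!: regular_sum regular_mult regular_prod regular_const)
qed

lemma polyfun_regular:
  assumes "regular g" "\<And>m. polyfun (\<lambda>t. lookup (F t) m)"
  shows "polyfun (\<lambda>t. g (F t))"
  using assms polyfun_poly_eval[of "\<lambda>t. lookup (F t)"] by (auto simp: regular_def)

text \<open>Shared by both Zariski topologies: a finite intersection of subbasic sets corresponds to
  a product of regular functions, and for a union one member suffices. \<open>P\<close> restricts
  the parameters for which \<open>x F\<close> is meaningful.\<close>

lemma generated_topology_neighbourhood:
  assumes "openin (topology_generated_by S) T" "x a \<in> T"
    and "\<And>B. B \<in> S \<Longrightarrow> x a \<in> B \<Longrightarrow>
           \<exists>g. regular g \<and> g a \<noteq> 0 \<and> (\<forall>F. P F \<and> g F \<noteq> 0 \<longrightarrow> x F \<in> B)"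
  shows "\<exists>g. regular g \<and> g a \<noteq> 0 \<and> (\<forall>F. P F \<and> g F \<noteq> 0 \<longrightarrow> x F \<in> T)"
proof -
  have "generate_topology_on S T" using assms(1) openin_topology_generated_by by blast
  then show ?thesis using assms(2)
  proof induction
    case (Int T1 T2)
    then obtain g h where "regular g" "g a \<noteq> 0" "\<forall>F. P F \<and> g F \<noteq> 0 \<longrightarrow> x F \<in> T1"
      "regular h" "h a \<noteq> 0" "\<forall>F. P F \<and> h F \<noteq> 0 \<longrightarrow> x F \<in> T2" by blast
    then show ?case by (intro exI[of _ "\<lambda>F. g F * h F"]) (auto intro: regular_mult)
  next
    case (UN K)
    then show ?case by (metis UnionE UnionI)
  qed (use assms(3) in auto)
qed

lemma pt_cscale: "t \<noteq> 0 \<Longrightarrow> pt (cscale t F) = pt F"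
  using cpoly.span_image_scale[of "{F}" "\<lambda>_. t"] by (simp add: pt_def)

lemma pt_eqD:
  assumes "pt F = pt G" "F \<noteq> 0"
  shows "\<exists>t. t \<noteq> 0 \<and> F = cscale t G"
proof -
  have "F \<in> pt G" using assms(1) by (metis cpoly.span_base insertI1 pt_def)
  then obtain t where "F = cscale t G" by (auto simp: pt_def cpoly.span_singleton)
  with assms(2) show ?thesis by auto
qed

lemma in_pt_self: "F \<in> pt F"
  by (simp add: pt_def cpoly.span_base)

text \<open>The set is the union of the non-vanishing loci of the homogeneous components of
  \<open>g\<close>: a nonzero value needs a nonzero component, and a nonzero component makes
  \<open>g\<close> nonzero at some rescaled representative.\<close>

lemma openin_regular_nonzero:
  assumes "regular g"
  shows "openin (proj_zariski d) (pt ` {F \<in> forms d - {0}. g F \<noteq> 0})"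
proof -
  obtain f where f: "\<And>F. g F = poly_eval (lookup F) f" using assms by (auto simp: regular_def)
  let ?U = "\<lambda>e. pt ` {F \<in> forms d - {0}. poly_eval (lookup F) (hom_component e f) \<noteq> 0}"
  have "pt ` {F \<in> forms d - {0}. g F \<noteq> 0} = (\<Union>e. ?U e)"
  proof
    show "pt ` {F \<in> forms d - {0}. g F \<noteq> 0} \<subseteq> (\<Union>e. ?U e)"
    proof
      fix p assume "p \<in> pt ` {F \<in> forms d - {0}. g F \<noteq> 0}"
      then obtain F where F: "F \<in> forms d - {0}" "g F \<noteq> 0" "p = pt F" by blast
      have "g F = (\<Sum>e\<in>mdeg ` keys f. poly_eval (lookup F) (hom_component e f))"
        by (metis f poly_eval_sum sum_hom_components)
      with F(2) obtain e where "poly_eval (lookup F) (hom_component e f) \<noteq> 0"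
        by (metis sum.neutral)
      with F show "p \<in> (\<Union>e. ?U e)" by blast
    qed
  next
    show "(\<Union>e. ?U e) \<subseteq> pt ` {F \<in> forms d - {0}. g F \<noteq> 0}"
    proof
      fix p assume "p \<in> (\<Union>e. ?U e)"
      then obtain e F where F: "F \<in> forms d - {0}" "p = pt F"
        and "poly_eval (lookup F) (hom_component e f) \<noteq> 0" by blast
      then obtain t where t: "t \<noteq> 0" "poly_eval (\<lambda>x. t * lookup F x) f \<noteq> 0"
        using poly_eval_scaled_nonzero by blast
      then have "g (cscale t F) \<noteq> 0" by (simp add: f lookup_cscale[abs_def])
      moreover have "cscale t F \<in> forms d - {0}"
        using F(1) t(1) cpoly.subspace_scale[OF forms_subspace] by auto
      ultimately show "p \<in> pt ` {F \<in> forms d - {0}. g F \<noteq> 0}"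
        using F(2) pt_cscale[OF t(1), of F] by (intro image_eqI[of _ _ "cscale t F"]) auto
    qed
  qed
  moreover have "openin (proj_zariski d) (?U e)" for e
    unfolding proj_zariski_def
    by (rule topology_generated_by_Basis) (use hom_component_in_forms in blast)
  ultimately show ?thesis by auto
qed

lemma proj_zariski_neighbourhood:
  assumes "openin (proj_zariski d) T" "F \<in> forms d - {0}" "pt F \<in> T"
  shows "\<exists>g. regular g \<and> g F \<noteq> 0 \<and> (\<forall>G. G \<in> forms d - {0} \<and> g G \<noteq> 0 \<longrightarrow> pt G \<in> T)"
proof (rule generated_topology_neighbourhood[OF assms(1)[unfolded proj_zariski_def]])
  fix B assume "B \<in> {pt ` {F \<in> forms d - {0}. poly_eval (lookup F) f \<noteq> 0} |f. \<exists>e. f \<in> forms e}"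
    and FB: "pt F \<in> B"
  then obtain f e where f: "f \<in> forms e"
    and B: "B = pt ` {F \<in> forms d - {0}. poly_eval (lookup F) f \<noteq> 0}" by blast
  \<comment> \<open>Membership in \<open>B\<close> provides some non-vanishing representative, not
    necessarily \<open>F\<close>; homogeneity of \<open>f\<close> carries the non-vanishing over to
    \<open>F\<close>.\<close>
  obtain G where G: "G \<in> forms d - {0}" "poly_eval (lookup G) f \<noteq> 0" "pt F = pt G"
    using FB B by auto
  then obtain t where "t \<noteq> 0" "F = cscale t G" using pt_eqD[of F G] assms(2) by auto
  then have "poly_eval (lookup F) f \<noteq> 0"
    using poly_eval_forms_scale[OF f, of t "lookup G"] G(2) by (simp add: lookup_cscale[abs_def])
  then show "\<exists>g. regular g \<and> g F \<noteq> 0 \<and> (\<forall>G. G \<in> forms d - {0} \<and> g G \<noteq> 0 \<longrightarrow> pt G \<in> B)"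
    unfolding B by (intro exI[of _ "\<lambda>F. poly_eval (lookup F) f"]) (auto simp: regular_def)
qed (use assms in auto)

lemma topspace_proj_zariski: "topspace (proj_zariski d) = proj_forms d"
proof
  show "topspace (proj_zariski d) \<subseteq> proj_forms d"
    unfolding proj_zariski_def topology_generated_by_topspace proj_forms_def by blast
  have "openin (proj_zariski d) (pt ` {F \<in> forms d - {0}. (1::complex) \<noteq> 0})"
    by (rule openin_regular_nonzero) (rule regular_const)
  then show "proj_forms d \<subseteq> topspace (proj_zariski d)"
    using openin_subset by (fastforce simp: proj_forms_def)
qed


section \<open>Dimension counts in spaces of forms\<close>

text \<open>A vector outside the span would extend \<open>B\<close> beyond the dimension. The finite
  \<open>C\<close> keeps \<open>cpoly.dim\<close> meaningful, since an infinite basis would have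
  cardinality 0.\<close>

lemma subset_span_of_dim_le:
  fixes V :: "'x cpoly set"
  assumes "cpoly.independent B" "finite B" "B \<subseteq> V" "V \<subseteq> cpoly.span C" "finite C"
    "cpoly.dim V \<le> card B"
  shows "V \<subseteq> cpoly.span B"
proof
  obtain B' where B': "B' \<subseteq> V" "cpoly.independent B'" "V \<subseteq> cpoly.span B'" "card B' = cpoly.dim V"
    using cpoly.basis_exists by blast
  have "finite B'" using cpoly.independent_span_bound[OF assms(5) B'(2)] B'(1) assms(4) by auto
  fix v assume v: "v \<in> V"
  show "v \<in> cpoly.span B"
  proof (rule ccontr)
    assume nv: "v \<notin> cpoly.span B"
    then have "cpoly.independent (insert v B)" using assms(1) by (rule cpoly.independent_insertI)
    then have "card (insert v B) \<le> card B'"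
      using cpoly.independent_span_bound[OF \<open>finite B'\<close>] v assms(3) B'(3) by blast
    moreover have "v \<notin> B" using nv cpoly.span_base by blast
    ultimately show False using assms(2,6) B'(4) by simp
  qed
qed

lemma span_subset_of_dim_ge:
  fixes V :: "'x cpoly set"
  assumes "finite B" "cpoly.subspace V" "V \<subseteq> cpoly.span B" "card B \<le> cpoly.dim V"
  shows "cpoly.span B \<subseteq> V"
proof -
  obtain B' where B': "B' \<subseteq> V" "cpoly.independent B'" "V \<subseteq> cpoly.span B'" "card B' = cpoly.dim V"
    using cpoly.basis_exists by blast
  have fin: "finite B'"
    using cpoly.independent_span_bound[OF assms(1) B'(2)] B'(1) assms(3) by auto
  have "B \<subseteq> cpoly.span B'"
  proof
    fix b assume b: "b \<in> B"
    show "b \<in> cpoly.span B'"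
    proof (rule ccontr)
      assume nb: "b \<notin> cpoly.span B'"
      then have "cpoly.independent (insert b B')" using B'(2) by (rule cpoly.independent_insertI)
      then have "card (insert b B') \<le> card B"
        using cpoly.independent_span_bound[OF assms(1)] b assms(3) B'(1) cpoly.span_base by blast
      moreover have "b \<notin> B'" using nb cpoly.span_base by blast
      ultimately show False using fin assms(4) B'(4) by simp
    qed
  qed
  moreover have "cpoly.span B' \<subseteq> V" using B'(1) assms(2) by (rule cpoly.span_minimal)
  ultimately show ?thesis using cpoly.span_minimal[of B "cpoly.span B'"] by auto
qed

text \<open>The coefficient matrix in the pivot columns is \<open>c\<close> times the identity.
  Keeping \<open>c\<close> instead of normalising it to 1 avoids denominators; it will be a power of
  the discriminant.\<close>

locale echelon_family =
  fixes G :: "'x monom set" and w :: "'x monom \<Rightarrow> 'x cpoly" and c :: complex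
  assumes finite_G: "finite G" and c_nonzero: "c \<noteq> 0"
    and pivots: "\<And>m m'. m \<in> G \<Longrightarrow> m' \<in> G \<Longrightarrow> lookup (w m) m' = (if m' = m then c else 0)"
begin

lemma inj_w: "inj_on w G"
  using pivots c_nonzero by (intro inj_onI) metis

lemma lookup_combination:
  assumes "m \<in> G"
  shows "lookup (\<Sum>m'\<in>G. cscale (u m') (w m')) m = c * u m"
proof -
  have "lookup (\<Sum>m'\<in>G. cscale (u m') (w m')) m = (\<Sum>m'\<in>G. if m' = m then u m' * c else 0)"
    unfolding lookup_sum by (rule sum.cong) (use assms pivots in auto)
  then show ?thesis using assms finite_G by simp
qed

lemma independent_w: "cpoly.independent (w ` G)"
proof (rule cpoly.independent_if_scalars_zero)
  fix f x assume "(\<Sum>x\<in>w ` G. cscale (f x) x) = 0" "x \<in> w ` G"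
  then obtain m where m: "m \<in> G" "x = w m" "(\<Sum>m\<in>G. cscale (f (w m)) (w m)) = 0"
    using sum.reindex[OF inj_w, of "\<lambda>x. cscale (f x) x"] by auto
  then have "c * f x = 0" using lookup_combination[of m "\<lambda>m. f (w m)"] by simp
  then show "f x = 0" using c_nonzero by simp
qed (use finite_G in simp)

lemma dim_span_w: "cpoly.dim (cpoly.span (w ` G)) = card G"
  using cpoly.dim_span_eq_card_independent[OF independent_w] card_image[OF inj_w] by simp

text \<open>Membership becomes the vanishing of an explicit remainder, polynomial in
  \<open>c\<close>, \<open>v\<close> and the \<open>w m\<close>. This is what later turns the ideal
  property into regular equations.\<close>

lemma in_span_w_iff:
  "v \<in> cpoly.span (w ` G) \<longleftrightarrow> cscale c v - (\<Sum>m\<in>G. cscale (lookup v m) (w m)) = 0"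
proof
  assume "v \<in> cpoly.span (w ` G)"
  then show "cscale c v - (\<Sum>m\<in>G. cscale (lookup v m) (w m)) = 0"
  proof (induction rule: cpoly.span_induct)
    case base
    show ?case
      by (rule cpoly.subspaceI)
        (auto simp: cpoly.scale_right_distrib cpoly.scale_left_distrib sum.distrib lookup_add
          cpoly.scale_left_commute[of c] cpoly.scale_sum_right simp flip: cpoly.scale_scale)
  next
    case (step x)
    then obtain m where m: "m \<in> G" "x = w m" by auto
    have "(\<Sum>m'\<in>G. cscale (lookup x m') (w m')) = (\<Sum>m'\<in>G. if m' = m then cscale c (w m') else 0)"
      using m pivots by (auto intro!: sum.cong)
    then show ?case using m finite_G by simp
  qed
next
  assume *: "cscale c v - (\<Sum>m\<in>G. cscale (lookup v m) (w m)) = 0"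
  have "v = cscale (1 / c) (cscale c v)" using c_nonzero by simp
  also have "\<dots> = cscale (1 / c) (\<Sum>m\<in>G. cscale (lookup v m) (w m))" using * by simp
  also have "\<dots> \<in> cpoly.span (w ` G)"
    by (intro cpoly.span_scale cpoly.span_sum cpoly.span_base imageI)
  finally show "v \<in> cpoly.span (w ` G)" .
qed

end

section \<open>Counting monomials\<close>

definition monomials :: "nat \<Rightarrow> 'x monom set" where
  "monomials k = {m. mdeg m = k}"

lemma finite_monomials [simp]: "finite (monomials k :: 'v::finite monom set)"
proof -
  have "finite (UNIV \<rightarrow>\<^sub>E {..k} :: ('v \<Rightarrow> nat) set)" by (intro finite_PiE) auto
  moreover have "inj (lookup :: 'v monom \<Rightarrow> _)" by (auto intro: injI poly_mapping_eqI)
  ultimately have "finite (lookup -` (UNIV \<rightarrow>\<^sub>E {..k}) :: 'v monom set)" by (rule finite_vimageI)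
  moreover have "monomials k \<subseteq> (lookup -` (UNIV \<rightarrow>\<^sub>E {..k}) :: 'v monom set)"
    by (auto simp: monomials_def mdeg_finite PiE_def intro!: member_le_sum)
  ultimately show ?thesis by (rule finite_subset[rotated])
qed

lemma echelon_monomials: "echelon_family (monomials k :: 'v::finite monom set) (\<lambda>m. single m 1) 1"
  by unfold_locales (auto simp: lookup_single when_def)

lemma forms_eq_span: "forms k = cpoly.span ((\<lambda>m. single m 1) ` (monomials k :: 'v::finite monom set))"
proof
  show "forms k \<subseteq> cpoly.span ((\<lambda>m. single m 1) ` (monomials k :: 'v monom set))"
  proof
    fix p :: "'v cpoly" assume "p \<in> forms k"
    then have "p = (\<Sum>m\<in>monomials k. single m (lookup p m))"
      by (intro poly_mapping_sum_single finite_monomials) (auto simp: forms_def monomials_def)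
    also have "\<dots> = (\<Sum>m\<in>monomials k. cscale (lookup p m) (single m 1))" by simp
    also have "\<dots> \<in> cpoly.span ((\<lambda>m. single m 1) ` monomials k)"
      by (intro cpoly.span_sum cpoly.span_scale cpoly.span_base imageI)
    finally show "p \<in> cpoly.span ((\<lambda>m. single m 1) ` monomials k)" .
  qed
  show "cpoly.span ((\<lambda>m. single m 1) ` (monomials k :: 'v monom set)) \<subseteq> forms k"
    by (rule cpoly.span_minimal[OF _ forms_subspace]) (auto simp: monomials_def intro: forms_single)
qed

lemma dim_forms: "cpoly.dim (forms k :: 'v::finite cpoly set) = card (monomials k :: 'v monom set)"
  unfolding forms_eq_span by (rule echelon_family.dim_span_w[OF echelon_monomials])

text \<open>Stars and bars: read along an enumeration of the variables, exponent vectors are the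
  lists of n + 1 naturals with sum k.\<close>

lemma card_monomials:
  assumes "CARD('v::finite) = n + 1"
  shows "card (monomials k :: 'v monom set) = (n + k) choose k"
proof -
  obtain h where h: "bij_betw h {0..<n + 1} (UNIV :: 'v set)"
    using ex_bij_betw_nat_finite[of "UNIV :: 'v set"] assms by auto
  let ?L = "{l :: nat list. size l = n + 1 \<and> sum_list l = k}"
  let ?f = "\<lambda>m :: 'v monom. map (\<lambda>i. lookup m (h i)) [0..<n + 1]"
  have surj_h: "\<exists>i<n + 1. x = h i" for x
    using h by (metis UNIV_I atLeastLessThan_iff bij_betw_def imageE)
  have sum_f: "sum_list (?f m) = mdeg m" for m
  proof -
    have "sum_list (?f m) = (\<Sum>i\<in>{0..<n + 1}. lookup m (h i))"
      by (subst interv_sum_list_conv_sum_set_nat) simp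
    also have "\<dots> = mdeg m" unfolding mdeg_finite by (rule sum.reindex_bij_betw[OF h])
    finally show ?thesis .
  qed
  have "bij_betw ?f (monomials k) ?L"
  proof (rule bij_betw_imageI)
    show "inj_on ?f (monomials k)"
    proof (rule inj_onI, rule poly_mapping_eqI)
      fix m m' x assume eq: "?f m = ?f m'"
      obtain i where "i < n + 1" "x = h i" using surj_h by blast
      then show "lookup m x = lookup m' x" using arg_cong[OF eq, of "\<lambda>l. l ! i"] by (simp del: upt_Suc)
    qed
    show "?f ` monomials k = ?L"
    proof
      show "?f ` monomials k \<subseteq> ?L" using sum_f by (auto simp: monomials_def simp del: upt_Suc)
      show "?L \<subseteq> ?f ` monomials k"
      proof
        fix l assume l: "l \<in> ?L"
        define m where "m = Poly_Mapping.Abs_poly_mapping (\<lambda>x. l ! inv_into {0..<n + 1} h x)"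
        have "lookup m (h i) = l ! i" if "i < n + 1" for i
          using that h unfolding m_def bij_betw_def by (subst lookup_Abs_poly_mapping) auto
        then have "?f m = l" using l by (intro nth_equalityI) (auto simp del: upt_Suc)
        moreover from this have "m \<in> monomials k" using l sum_f[of m] by (simp add: monomials_def del: upt_Suc)
        ultimately show "l \<in> ?f ` monomials k" by blast
      qed
    qed
  qed
  then have "card (monomials k :: 'v monom set) = card ?L" by (rule bij_betw_same_card)
  also have "\<dots> = (n + k) choose k" by (simp add: card_length_sum_list add.commute)
  finally show ?thesis .
qed

lemma card_monomials_mono:
  assumes "k \<le> l"
  shows "card (monomials k :: 'v::finite monom set) \<le> card (monomials l :: 'v monom set)"
proof (rule card_inj_on_le)
  show "(\<lambda>m. single undefined (l - k) + m) ` (monomials k :: 'v monom set) \<subseteq> monomials l"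
    using assms by (auto simp: monomials_def mdeg_add)
qed (auto intro: inj_onI)

lemma card_monomials_pos: "card (monomials k :: 'v::finite monom set) > 0"
proof -
  have "single undefined k \<in> (monomials k :: 'v monom set)" by (simp add: monomials_def)
  then show ?thesis by (metis card_gt_0_iff empty_iff finite_monomials)
qed


section \<open>Apolarity as a pairing\<close>

text \<open>
  For \<open>\<psi>\<close> and \<open>F\<close> of the same degree, \<open>pairing F \<psi>\<close> is the constant \<open>\<psi> \<circ> F\<close>; in
  general it is the constant term of \<open>\<psi> \<circ> F\<close>.
\<close>

definition mono_fact :: "'v::finite monom \<Rightarrow> complex" where
  "mono_fact m = (\<Prod>x\<in>UNIV. fact (lookup m x))"

definition pairing :: "'v::finite cpoly \<Rightarrow> 'v cpoly \<Rightarrow> complex" where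
  "pairing F \<psi> = (\<Sum>m\<in>keys \<psi>. lookup \<psi> m * (lookup F m * mono_fact m))"

lemma mono_fact_nonzero [simp]: "mono_fact m \<noteq> 0"
  by (simp add: mono_fact_def)

lemma pairing_superset:
  "finite A \<Longrightarrow> keys \<psi> \<subseteq> A \<Longrightarrow> pairing F \<psi> = (\<Sum>m\<in>A. lookup \<psi> m * (lookup F m * mono_fact m))"
  unfolding pairing_def by (rule sum.mono_neutral_left) (auto simp: in_keys_iff)

lemma pairing_zero [simp]: "pairing F 0 = 0"
  by (simp add: pairing_def)

lemma pairing_zero_left [simp]: "pairing 0 \<psi> = 0"
  by (simp add: pairing_def)

lemma pairing_single [simp]: "pairing F (single m c) = c * (lookup F m * mono_fact m)"
  by (simp add: pairing_def)

lemma pairing_add: "pairing F (p + q) = pairing F p + pairing F q"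
  using pairing_superset[of "keys p \<union> keys q" "p + q" F]
    pairing_superset[of "keys p \<union> keys q" p F] pairing_superset[of "keys p \<union> keys q" q F]
    Poly_Mapping.keys_add[of p q]
  by (simp add: lookup_add distrib_right sum.distrib)

lemma pairing_sum: "pairing F (\<Sum>i\<in>A. f i) = (\<Sum>i\<in>A. pairing F (f i))"
  by (induction A rule: infinite_finite_induct) (auto simp: pairing_add)

lemma pairing_cscale: "pairing F (cscale c p) = c * pairing F p"
  using pairing_superset[of "keys p" "cscale c p" F] keys_cscale_subset[of c p]
  by (simp add: pairing_def sum_distrib_left mult.assoc)

lemma pairing_diff: "pairing F (p - q) = pairing F p - pairing F q"
  using pairing_add[of F "p - q" q] by simp

lemma pairing_sum_left: "pairing (\<Sum>i\<in>A. f i) \<psi> = (\<Sum>i\<in>A. pairing (f i) \<psi>)"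
  unfolding pairing_def lookup_sum sum_distrib_right sum_distrib_left by (rule sum.swap)

lemma pairing_cscale_left: "pairing (cscale c F) \<psi> = c * pairing F \<psi>"
  by (simp add: pairing_def sum_distrib_left mult_ac)

lemma pairing_forms_eq_0:
  "F \<in> forms d \<Longrightarrow> \<psi> \<in> forms k \<Longrightarrow> k \<noteq> d \<Longrightarrow> pairing F \<psi> = 0"
  unfolding pairing_def by (intro sum.neutral) (auto simp: forms_lookup)

lemma prod_falling_factorial: "(\<Prod>j<a. a + c - j) * fact c = (fact (a + c) :: nat)"
proof (induction a)
  case (Suc a)
  have "(\<Prod>j<Suc a. Suc a + c - j) = (Suc a + c) * (\<Prod>j<a. a + c - j)"
    by (subst prod.lessThan_Suc_shift) simp
  then have "(\<Prod>j<Suc a. Suc a + c - j) * fact c = (Suc a + c) * ((\<Prod>j<a. a + c - j) * fact c)"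
    by (simp only: mult.assoc)
  then show ?case unfolding Suc.IH by simp
qed simp

text \<open>Differentiating further by the monomial \<open>c\<close> moves the coefficient at
  \<open>c\<close> into the constant term, with factor \<open>mono_fact c\<close>. Annihilation
  thereby becomes a family of linear conditions on \<psi>.\<close>

lemma lookup_apolar:
  "lookup (apolar \<psi> F) c * mono_fact c = pairing F (\<psi> * single c 1)"
proof -
  define N where
    "N a b = (of_nat (\<Prod>i\<in>UNIV. \<Prod>j<lookup a i. lookup b i - j) :: complex)" for a b :: "'a monom"
  have N_add: "N a (a + c) * mono_fact c = mono_fact (a + c)" for a
  proof -
    define P where "P i = (\<Prod>j<lookup a i. lookup (a + c) i - j)" for i
    have P: "P i * fact (lookup c i) = fact (lookup (a + c) i)" for i
      unfolding P_def lookup_add by (rule prod_falling_factorial)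
    have "N a (a + c) * mono_fact c = of_nat (\<Prod>i\<in>UNIV. P i * fact (lookup c i))"
      unfolding N_def P_def[symmetric] mono_fact_def prod.distrib of_nat_mult of_nat_prod of_nat_fact ..
    then show ?thesis unfolding P by (simp add: mono_fact_def)
  qed
  have inner: "(\<Sum>b\<in>keys F. lookup (single (b - a) (lookup \<psi> a * lookup F b * N a b)) c) * mono_fact c
      = lookup \<psi> a * (lookup F (a + c) * mono_fact (a + c))" for a
  proof -
    have "lookup (single (b - a) (lookup \<psi> a * lookup F b * N a b)) c
        = (if b = a + c then lookup \<psi> a * lookup F b * N a b else 0)" for b
    \<comment> \<open>Truncated subtraction can produce \<open>b - a = c\<close> although
      \<open>b \<noteq> a + c\<close>. In that case some exponent of \<open>a\<close> exceeds that
      of \<open>b\<close>, and the falling factorial contains the factor 0.\<close>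
    proof (cases "\<forall>i. lookup a i \<le> lookup b i")
      case True
      then have "b = a + (b - a)" by (intro poly_mapping_eqI) (simp add: lookup_minus lookup_add)
      then have "b - a = c \<longleftrightarrow> b = a + c" by (metis add_diff_cancel_left')
      then show ?thesis by (auto simp: lookup_single when_def)
    next
      case False
      then obtain i where i: "lookup b i < lookup a i" by (auto simp: not_le)
      then have "(\<Prod>j<lookup a i. lookup b i - j) = 0" by (auto intro!: bexI[of _ "lookup b i"])
      then have "(\<Prod>i\<in>UNIV. \<Prod>j<lookup a i. lookup b i - j) = 0"
        by (intro prod_zero[OF finite]) (rule bexI[OF _ UNIV_I])
      then have "N a b = 0" by (simp only: N_def of_nat_0)
      moreover have "b \<noteq> a + c" using i by (auto simp: lookup_add)
      ultimately show ?thesis by (simp add: lookup_single)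
    qed
    then have "(\<Sum>b\<in>keys F. lookup (single (b - a) (lookup \<psi> a * lookup F b * N a b)) c)
        = lookup \<psi> a * lookup F (a + c) * N a (a + c)"
      by (simp add: in_keys_iff)
    also have "\<dots> * mono_fact c = lookup \<psi> a * (lookup F (a + c) * (N a (a + c) * mono_fact c))"
      by (simp only: mult.assoc)
    finally show ?thesis unfolding N_add .
  qed
  have "lookup (apolar \<psi> F) c * mono_fact c
      = (\<Sum>a\<in>keys \<psi>. lookup \<psi> a * (lookup F (a + c) * mono_fact (a + c)))"
    unfolding apolar_def N_def[symmetric] lookup_sum
    by (subst sum_distrib_right) (rule sum.cong[OF refl inner])
  also have "\<dots> = pairing F ((\<Sum>a\<in>keys \<psi>. single a (lookup \<psi> a)) * single c 1)"
    by (simp add: sum_distrib_right mult_single pairing_sum)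
  finally show ?thesis using poly_mapping_sum_single[of "keys \<psi>" \<psi>] by simp
qed

lemma Ann_iff_single: "\<psi> \<in> Ann F \<longleftrightarrow> (\<forall>c. pairing F (\<psi> * single c 1) = 0)"
  unfolding Ann_def lookup_apolar[symmetric] by (auto simp: poly_mapping_eq_iff fun_eq_iff)

lemma Ann_iff: "\<psi> \<in> Ann F \<longleftrightarrow> (\<forall>p. pairing F (\<psi> * p) = 0)"
proof
  assume \<psi>: "\<psi> \<in> Ann F"
  show "\<forall>p. pairing F (\<psi> * p) = 0"
  proof
    fix p show "pairing F (\<psi> * p) = 0"
    proof (induction p rule: poly_mapping_additive_induct)
      case (single m c)
      then show ?case using \<psi> pairing_cscale[of F c "\<psi> * single m 1"]
        by (simp add: Ann_iff_single flip: cscale_mult_right)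
    qed (auto simp: distrib_left pairing_add)
  qed
qed (simp add: Ann_iff_single)

lemma ideal_iff:
  "module.subspace (*) (I :: 'a::comm_ring_1 set) \<longleftrightarrow>
     0 \<in> I \<and> (\<forall>p\<in>I. \<forall>q\<in>I. p + q \<in> I) \<and> (\<forall>c. \<forall>p\<in>I. c * p \<in> I)"
proof -
  have "Modules.module ((*) :: 'a \<Rightarrow> 'a \<Rightarrow> 'a)" by unfold_locales (auto simp: algebra_simps)
  then show ?thesis by (rule module.subspace_def)
qed

lemma ideal_Ann: "module.subspace (*) (Ann F)"
  unfolding ideal_iff
proof (intro conjI ballI allI)
  fix c p assume "p \<in> Ann F"
  then have "pairing F (p * (c * q)) = 0" for q by (simp add: Ann_iff)
  then show "c * p \<in> Ann F" by (simp add: Ann_iff mult_ac)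
qed (auto simp: Ann_iff distrib_right pairing_add)

lemma ideal_subspace: "module.subspace (*) I \<Longrightarrow> cpoly.subspace I"
  by (rule cpoly.subspaceI) (auto simp: ideal_iff cscale_def)


section \<open>Powers of linear forms\<close>

definition eval_at :: "'v cpoly \<Rightarrow> 'v cpoly \<Rightarrow> complex" where
  "eval_at l = poly_eval (\<lambda>i. lookup l (single i 1))"

lemma sum_linear_form:
  fixes l :: "'v::finite cpoly"
  assumes "l \<in> forms 1"
  shows "l = (\<Sum>i\<in>UNIV. single (single i 1) (lookup l (single i 1)))"
proof -
  have "m \<in> range (\<lambda>i. single i 1)" if "mdeg m = 1" for m :: "'v monom"
  proof -
    have "keys m \<noteq> {}" using that by auto
    then obtain i where "i \<in> keys m" by blast
    then have i: "lookup m i \<ge> 1" by (simp add: in_keys_iff)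
    then have "m = single i 1 + (m - single i 1)"
      by (auto simp: poly_mapping_eq_iff fun_eq_iff lookup_add lookup_minus lookup_single when_def)
    then have "mdeg m = 1 + mdeg (m - single i 1)" by (metis mdeg_add mdeg_single)
    with that have "m - single i 1 = 0" by simp
    with \<open>m = single i 1 + (m - single i 1)\<close> show ?thesis by simp
  qed
  then have "keys l \<subseteq> range (\<lambda>i. single i 1)" using assms by (auto simp: forms_def)
  then have "l = (\<Sum>m\<in>range (\<lambda>i. single i 1). single m (lookup l m))"
    by (intro poly_mapping_sum_single) auto
  also have "\<dots> = (\<Sum>i\<in>UNIV. single (single i 1) (lookup l (single i 1)))"
    by (subst sum.reindex) (auto simp: inj_on_def dest: arg_cong[of _ _ keys])
  finally show ?thesis .
qed

text \<open>The multinomial theorem, normalised for the pairing. In the induction the i-th term of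
  the linear form contributes with weight \<open>lookup m i\<close>, and these weights add up to the
  degree \<open>Suc d\<close>.\<close>

lemma lookup_power_linear_form:
  fixes l :: "'v::finite cpoly"
  assumes "l \<in> forms 1"
  shows "lookup (l ^ d) m * mono_fact m
    = (if mdeg m = d then fact d * mono_eval (\<lambda>i. lookup l (single i 1)) m else 0)"
proof (induction d arbitrary: m)
  case 0
  then show ?case by (auto simp: lookup_one when_def mono_fact_def)
next
  case (Suc d)
  define a where "a = (\<lambda>i. lookup l (single i 1))"
  have l: "l = (\<Sum>i\<in>UNIV. single (single i 1) (a i))"
    unfolding a_def by (rule sum_linear_form[OF assms])
  have step: "lookup (single (single i 1) (a i) * l ^ d) m * mono_fact m
      = (if mdeg m = Suc d then of_nat (lookup m i) * (fact d * mono_eval a m) else 0)" for i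
  proof (cases "lookup m i = 0")
    case True
    then have "\<nexists>b. m = single i 1 + b" by (auto simp: lookup_add)
    then show ?thesis using True by (simp add: lookup_single_mult)
  next
    case False
    define b where "b = m - single i 1"
    have m: "m = single i 1 + b"
      using False unfolding b_def
      by (auto simp: poly_mapping_eq_iff fun_eq_iff lookup_add lookup_minus lookup_single when_def)
    have fact: "mono_fact m = of_nat (lookup m i) * mono_fact b"
    proof -
      have "mono_fact m = fact (lookup m i) * (\<Prod>x\<in>UNIV - {i}. fact (lookup m x))"
        unfolding mono_fact_def by (rule prod.remove) auto
      also have "\<dots> = of_nat (lookup m i) * (fact (lookup b i) * (\<Prod>x\<in>UNIV - {i}. fact (lookup b x)))"
        by (simp add: m lookup_add lookup_single)
      also have "fact (lookup b i) * (\<Prod>x\<in>UNIV - {i}. fact (lookup b x)) = mono_fact b"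
        unfolding mono_fact_def by (rule prod.remove[symmetric]) auto
      finally show ?thesis .
    qed
    have "lookup (single (single i 1) (a i) * l ^ d) m * mono_fact m
        = a i * of_nat (lookup m i) * (lookup (l ^ d) b * mono_fact b)"
      unfolding fact using lookup_single_mult_add[of "single i 1" "a i" "l ^ d" b] m by simp
    also have "lookup (l ^ d) b * mono_fact b = (if mdeg b = d then fact d * mono_eval a b else 0)"
      using Suc.IH[of b] by (simp add: a_def)
    also have "a i * of_nat (lookup m i) * (if mdeg b = d then fact d * mono_eval a b else 0)
        = (if mdeg m = Suc d then of_nat (lookup m i) * (fact d * mono_eval a m) else 0)"
      using arg_cong[OF m, of mdeg] arg_cong[OF m, of "mono_eval a"]
      by (auto simp: mdeg_add mono_eval_add)
    finally show ?thesis .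
  qed
  have "lookup (l ^ Suc d) m * mono_fact m
      = (\<Sum>i\<in>UNIV. lookup (single (single i 1) (a i) * l ^ d) m * mono_fact m)"
    by (subst power_Suc, subst l) (simp add: sum_distrib_right lookup_sum)
  also have "\<dots> = (if mdeg m = Suc d then fact (Suc d) * mono_eval a m else 0)"
    unfolding step by (auto simp: mdeg_finite simp flip: sum_distrib_right of_nat_sum)
  finally show ?case by (simp add: a_def)
qed

text \<open>The link between apolarity and geometry: up to the factor \<open>fact d\<close>, the
  power \<open>l ^ d\<close> is the functional of evaluation at the point \<open>l\<close>.\<close>

lemma pairing_power_linear_form:
  assumes "l \<in> forms 1" "\<psi> \<in> forms d"
  shows "pairing (l ^ d) \<psi> = fact d * eval_at l \<psi>"
proof -
  have "pairing (l ^ d) \<psi>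
      = (\<Sum>m\<in>keys \<psi>. lookup \<psi> m * (fact d * mono_eval (\<lambda>i. lookup l (single i 1)) m))"
    unfolding pairing_def lookup_power_linear_form[OF assms(1)]
    using assms(2) by (auto simp: forms_def intro!: sum.cong)
  then show ?thesis
    by (simp add: eval_at_def poly_eval_superset[OF finite_keys order_refl] sum_distrib_left mult_ac)
qed

text \<open>The coefficients are kept apart from the linear forms so that a form of smaller rank
  still has exactly r summands, some with coefficient 0, and so that coefficients and points can be
  deformed independently.\<close>

definition power_sum_form :: "nat \<Rightarrow> nat \<Rightarrow> (nat \<Rightarrow> complex) \<Rightarrow> (nat \<Rightarrow> 'v::finite cpoly) \<Rightarrow> 'v cpoly" where
  "power_sum_form d r c l = (\<Sum>j<r. cscale (c j) (l j ^ d))"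

lemma power_sum_form_in_forms:
  assumes "\<And>j. j < r \<Longrightarrow> l j \<in> forms 1"
  shows "power_sum_form d r c l \<in> forms d"
  unfolding power_sum_form_def
  using assms forms_power[of _ 1 d]
  by (intro cpoly.subspace_sum[OF forms_subspace] cpoly.subspace_scale[OF forms_subspace]) auto

lemma pairing_power_sum_form:
  assumes "\<And>j. j < r \<Longrightarrow> l j \<in> forms 1" "\<psi> \<in> forms d"
  shows "pairing (power_sum_form d r c l) \<psi> = fact d * (\<Sum>j<r. c j * eval_at (l j) \<psi>)"
  unfolding power_sum_form_def pairing_sum_left pairing_cscale_left sum_distrib_left
  using assms by (auto simp: pairing_power_linear_form intro!: sum.cong)

lemma polyfun_lookup_power_sum_form:
  assumes "\<And>j t. j < r \<Longrightarrow> l t j \<in> forms 1" "\<And>j. polyfun (\<lambda>t. c t j)"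
    and "\<And>j m. polyfun (\<lambda>t. lookup (l t j) m)"
  shows "polyfun (\<lambda>t. lookup (power_sum_form d r (c t) (l t)) m)"
proof -
  let ?e = "\<lambda>t j. if mdeg m = d then fact d * mono_eval (\<lambda>i. lookup (l t j) (single i 1)) m else 0"
  have "lookup (l t j ^ d) m = ?e t j * inverse (mono_fact m)" if "j < r" for t j
    using lookup_power_linear_form[OF assms(1)[OF that], of t d m] by (simp add: divide_simps)
  then have "lookup (power_sum_form d r (c t) (l t)) m
      = (\<Sum>j<r. c t j * (?e t j * inverse (mono_fact m)))" for t
    by (simp add: power_sum_form_def lookup_sum)
  moreover have "polyfun (\<lambda>t. ?e t j)" for j
    unfolding mono_eval_def
    by (cases "mdeg m = d") (auto intro!: polyfun_mult polyfun_prod polyfun_power assms(3) polyfun_const)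
  ultimately show ?thesis by (auto intro!: polyfun_sum polyfun_mult assms(2) polyfun_const)
qed


section \<open>Points of secant varieties\<close>

definition spanned_points :: "nat \<Rightarrow> nat \<Rightarrow> 'v::finite cpoly set set" where
  "spanned_points r d = {p \<in> proj_forms d.
     \<exists>A \<subseteq> veronese d. finite A \<and> card A \<le> r \<and> p \<subseteq> cpoly.span (\<Union>A)}"

lemma secant_variety_eq: "secant_variety r d = proj_zariski d closure_of spanned_points r d"
  by (simp add: secant_variety_def spanned_points_def)

lemma proj_forms_ptD: "pt F \<in> proj_forms d \<Longrightarrow> F \<in> forms d - {0}"
proof -
  assume "pt F \<in> proj_forms d"
  then obtain G where G: "G \<in> forms d - {0}" "pt G = pt F" by (auto simp: proj_forms_def)
  then obtain t where t: "t \<noteq> 0" "G = cscale t F" using pt_eqD[of G F] by auto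
  then have "F = cscale (1 / t) G" by simp
  then have "F \<in> forms d" using G(1) cpoly.subspace_scale[OF forms_subspace] by blast
  then show ?thesis using G t by auto
qed

text \<open>One linear form is picked for each Veronese point. Recording that the coefficients
  vanish from index k on is what later excludes a border rank below r.\<close>

lemma spanned_points_power_sum:
  assumes "pt F \<in> spanned_points k d" "k \<le> r"
  shows "\<exists>c l. F = power_sum_form d r c l \<and> (\<forall>j. l j \<in> forms 1) \<and> (\<forall>j\<ge>k. c j = 0)"
proof -
  obtain A where A: "A \<subseteq> veronese d" "finite A" "card A \<le> k" "pt F \<subseteq> cpoly.span (\<Union>A)"
    using assms(1) by (auto simp: spanned_points_def)
  obtain h where h: "bij_betw h {0..<card A} A" using ex_bij_betw_nat_finite[OF A(2)] by blast
  have "\<forall>j<card A. \<exists>l. l \<in> forms 1 \<and> h j = pt (l ^ d)"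
  proof (intro allI impI)
    fix j assume "j < card A"
    then have "h j \<in> veronese d" using A(1) h bij_betwE by fastforce
    then show "\<exists>l. l \<in> forms 1 \<and> h j = pt (l ^ d)" by (auto simp: veronese_def)
  qed
  then obtain l where l: "\<And>j. j < card A \<Longrightarrow> l j \<in> forms 1" "\<And>j. j < card A \<Longrightarrow> h j = pt (l j ^ d)"
    by metis
  let ?f = "\<lambda>j. l j ^ d"
  have inj: "inj_on ?f {..<card A}"
  proof (rule inj_onI)
    fix i j assume "i \<in> {..<card A}" "j \<in> {..<card A}" "?f i = ?f j"
    then have "h i = h j" "i \<in> {0..<card A}" "j \<in> {0..<card A}" using l(2) by auto
    then show "i = j" using bij_betw_imp_inj_on[OF h] by (meson inj_onD)
  qed
  have "\<Union>A \<subseteq> cpoly.span (?f ` {..<card A})"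
  proof
    fix x assume "x \<in> \<Union>A"
    then obtain p where p: "p \<in> A" "x \<in> p" by blast
    have "p \<in> h ` {0..<card A}" using p(1) bij_betw_imp_surj_on[OF h] by (rule ssubst[rotated])
    then obtain j where j: "j < card A" "p = h j" by auto
    have "x \<in> cpoly.span {?f j}"
      using p(2) unfolding j(2) l(2)[OF j(1)] pt_def .
    moreover have "cpoly.span {?f j} \<subseteq> cpoly.span (?f ` {..<card A})"
      using j(1) by (intro cpoly.span_mono) auto
    ultimately show "x \<in> cpoly.span (?f ` {..<card A})" by (rule subsetD[rotated])
  qed
  then have "cpoly.span (\<Union>A) \<subseteq> cpoly.span (?f ` {..<card A})"
    by (rule cpoly.span_minimal) simp
  then have "F \<in> cpoly.span (?f ` {..<card A})" using A(4) in_pt_self[of F]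
    by (meson subsetD)
  then obtain u where u: "F = (\<Sum>x\<in>?f ` {..<card A}. cscale (u x) x)"
    by (auto simp: cpoly.span_finite)
  \<comment> \<open>Padding with zeros beyond \<open>card A\<close>, which also makes
    \<open>l'\<close> a linear form at every index.\<close>
  define c where "c j = (if j < card A then u (?f j) else 0)" for j
  define l' where "l' j = (if j < card A then l j else 0)" for j
  have "F = (\<Sum>j<card A. cscale (c j) (l' j ^ d))"
    unfolding u by (subst sum.reindex[OF inj]) (auto simp: c_def l'_def)
  also have "\<dots> = power_sum_form d r c l'"
    unfolding power_sum_form_def
    by (rule sum.mono_neutral_left) (use A(3) assms(2) in \<open>auto simp: c_def\<close>)
  finally have "F = power_sum_form d r c l'" .
  moreover have "\<forall>j. l' j \<in> forms 1" using l(1) by (auto simp: l'_def)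
  moreover have "\<forall>j\<ge>k. c j = 0" using A(3) by (auto simp: c_def)
  ultimately show ?thesis by blast
qed

lemma power_sum_in_spanned_points:
  assumes "\<And>j. j < r \<Longrightarrow> l j \<in> forms 1" "power_sum_form d r c l \<noteq> 0" "d > 0"
  shows "pt (power_sum_form d r c l) \<in> spanned_points r d"
proof -
  let ?F = "power_sum_form d r c l"
  let ?A = "(\<lambda>j. pt (l j ^ d)) ` {j \<in> {..<r}. l j \<noteq> 0}"
  have "?A \<subseteq> veronese d" using assms(1) by (auto simp: veronese_def)
  moreover have "card ?A \<le> r"
    using card_image_le[of "{j \<in> {..<r}. l j \<noteq> 0}" "\<lambda>j. pt (l j ^ d)"]
      card_mono[of "{..<r}" "{j \<in> {..<r}. l j \<noteq> 0}"] by (simp add: subset_eq)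
  moreover have "?F \<in> cpoly.span (\<Union>?A)"
    unfolding power_sum_form_def
  proof (rule cpoly.span_sum)
    fix j assume j: "j \<in> {..<r}"
    show "cscale (c j) (l j ^ d) \<in> cpoly.span (\<Union>?A)"
    \<comment> \<open>A zero linear form gives no Veronese point, but its power is 0 because d is
      positive.\<close>
    proof (cases "l j = 0")
      case True
      then show ?thesis using assms(3) by (simp add: cpoly.span_zero zero_power)
    next
      case False
      then have "l j ^ d \<in> \<Union>?A" using j in_pt_self by blast
      then show ?thesis by (intro cpoly.span_scale cpoly.span_base)
    qed
  qed
  then have "pt ?F \<subseteq> cpoly.span (\<Union>?A)"
    unfolding pt_def by (intro cpoly.span_minimal) auto
  moreover have "pt ?F \<in> proj_forms d"
    using power_sum_form_in_forms[of r l d c] assms by (auto simp: proj_forms_def)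
  ultimately show ?thesis
    unfolding spanned_points_def by (intro CollectI conjI exI[of _ ?A]) auto
qed

lemma secant_variety_subset: "secant_variety r d \<subseteq> proj_forms d"
  unfolding secant_variety_eq topspace_proj_zariski[symmetric] by (rule closure_of_subset_topspace)

text \<open>Read contrapositively: a regular function that vanishes at all nonzero power sums of
  length k vanishes on the whole secant variety. Facts about closures of power sums are obtained
  through this lemma.\<close>

lemma secant_variety_dense:
  assumes "pt F \<in> secant_variety k d" "k \<le> r" "regular g" "g F \<noteq> 0"
  shows "\<exists>c l. (\<forall>j. l j \<in> forms 1) \<and> (\<forall>j\<ge>k. c j = 0)
    \<and> power_sum_form d r c l \<noteq> 0 \<and> g (power_sum_form d r c l) \<noteq> 0"
proof -
  let ?T = "pt ` {F \<in> forms d - {0}. g F \<noteq> 0}"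
  have F: "F \<in> forms d - {0}"
    using assms(1) secant_variety_subset proj_forms_ptD by (metis subsetD)
  then have "pt F \<in> ?T" using assms(4) by auto
  moreover have "openin (proj_zariski d) ?T" by (rule openin_regular_nonzero[OF assms(3)])
  moreover have "\<forall>T. pt F \<in> T \<and> openin (proj_zariski d) T \<longrightarrow> (\<exists>p. p \<in> spanned_points k d \<and> p \<in> T)"
    using assms(1) unfolding secant_variety_eq in_closure_of by (rule conjunct2)
  ultimately obtain p where p: "p \<in> spanned_points k d" "p \<in> ?T" by (metis (no_types, lifting))
  then obtain G where G: "G \<in> forms d - {0}" "g G \<noteq> 0" "p = pt G"
    by auto
  then obtain c l where "G = power_sum_form d r c l" "\<forall>j. l j \<in> forms 1" "\<forall>j\<ge>k. c j = 0"
    using spanned_points_power_sum[OF _ assms(2)] p(1) by metis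
  then show ?thesis using G(1,2) by auto
qed


section \<open>The catalecticant and its reduction map\<close>

locale catalecticant =
  fixes z :: "'v::finite" and s :: nat and ms :: "'v monom list"
  assumes distinct_ms: "distinct ms" and set_ms: "set ms = monomials s"
begin

abbreviation r :: nat where "r \<equiv> length ms"

abbreviation z_power :: "nat \<Rightarrow> 'v cpoly" where "z_power k \<equiv> single (single z k) 1"

lemma r_eq: "r = card (monomials s :: 'v monom set)"
  using distinct_card[OF distinct_ms] set_ms by simp

lemma r_pos: "r > 0"
  unfolding r_eq by (rule card_monomials_pos)

lemma mdeg_ms: "i < r \<Longrightarrow> mdeg (ms ! i) = s"
  using nth_mem[of i ms] set_ms by (simp add: monomials_def)

lemma forms_expansion:
  assumes "q \<in> forms s"
  shows "q = (\<Sum>i<r. cscale (lookup q (ms ! i)) (single (ms ! i) 1))"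
proof -
  have "q = (\<Sum>m\<in>set ms. single m (lookup q m))"
    using assms unfolding set_ms
    by (intro poly_mapping_sum_single finite_monomials) (auto simp: monomials_def forms_def)
  also have "\<dots> = (\<Sum>i<r. single (ms ! i) (lookup q (ms ! i)))"
    by (rule sum.reindex_bij_betw[symmetric]) (rule bij_betw_nth[OF distinct_ms refl refl])
  finally show ?thesis by simp
qed

lemma lookup_combination_ms:
  assumes "k < r"
  shows "lookup (\<Sum>i<r. cscale (u i) (single (ms ! i) 1)) (ms ! k) = u k"
proof -
  have "lookup (\<Sum>i<r. cscale (u i) (single (ms ! i) 1)) (ms ! k) = (\<Sum>i<r. if i = k then u i else 0)"
    unfolding lookup_sum
    using assms nth_eq_iff_index_eq[OF distinct_ms]
    by (intro sum.cong) (auto simp: lookup_single when_def)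
  then show ?thesis using assms by simp
qed

text \<open>The Gram matrix, in the monomial basis \<open>ms\<close>, of the symmetric bilinear form
  that sends p and q to the constant term of z p q applied to F.\<close>

definition catal :: "'v cpoly \<Rightarrow> complex mat" where
  "catal F = mat r r (\<lambda>(i, j). pairing F (single (single z 1 + ms ! i + ms ! j) 1))"

definition disc :: "'v cpoly \<Rightarrow> complex" where
  "disc F = det (catal F)"

lemma catal_carrier: "catal F \<in> carrier_mat r r"
  by (simp add: catal_def)

lemma regular_disc: "regular disc"
  unfolding disc_def[abs_def] catal_def pairing_single
  by (intro regular_det regular_mult regular_const regular_lookup)

lemma disc_zero [simp]: "disc 0 = 0"
proof -
  have "catal 0 *\<^sub>v unit_vec r 0 = 0\<^sub>v r"
    by (rule eq_vecI) (auto simp: catal_def scalar_prod_def)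
  moreover have "unit_vec r 0 \<noteq> (0\<^sub>v r :: complex vec)"
    using r_pos by (metis index_unit_vec(2) index_zero_vec(1) zero_neq_one)
  ultimately show ?thesis
    unfolding disc_def det_0_iff_vec_prod_zero[OF catal_carrier] using unit_vec_carrier by blast
qed

lemma pairing_z_mult:
  assumes "q \<in> forms s" "j < r"
  shows "pairing F (z_power 1 * q * single (ms ! j) 1) = (\<Sum>i<r. catal F $$ (j, i) * lookup q (ms ! i))"
proof -
  have "z_power 1 * q * single (ms ! j) 1
      = (\<Sum>i<r. cscale (lookup q (ms ! i)) (single (single z 1 + ms ! j + ms ! i) 1))"
    by (subst forms_expansion[OF assms(1)])
      (simp add: sum_distrib_left sum_distrib_right mult_single add_ac)
  then show ?thesis
    using assms(2) by (simp add: pairing_sum catal_def mult_ac)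
qed

text \<open>The coefficient vector of \<open>q\<close> lies in the kernel of \<open>catal F\<close>.
  Consequently z S_s meets the relations of F only in 0.\<close>

lemma nondegenerate:
  assumes "disc F \<noteq> 0" "q \<in> forms s"
    and "\<And>j. j < r \<Longrightarrow> pairing F (z_power 1 * q * single (ms ! j) 1) = 0"
  shows "q = 0"
proof -
  define v where "v = vec r (\<lambda>i. lookup q (ms ! i))"
  have "catal F *\<^sub>v v = 0\<^sub>v r"
  proof (rule eq_vecI)
    fix j assume j: "j < dim_vec (0\<^sub>v r :: complex vec)"
    then have "(catal F *\<^sub>v v) $ j = (\<Sum>i<r. catal F $$ (j, i) * lookup q (ms ! i))"
      using catal_carrier[of F] by (simp add: scalar_prod_def v_def lessThan_atLeast0)
    then show "(catal F *\<^sub>v v) $ j = 0\<^sub>v r $ j"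
      using pairing_z_mult[OF assms(2), of j F] assms(3)[of j] j by simp
  qed (use catal_carrier in auto)
  moreover have "v \<in> carrier_vec r" by (simp add: v_def)
  ultimately have "v = 0\<^sub>v r"
    using assms(1) unfolding disc_def det_0_iff_vec_prod_zero[OF catal_carrier] by metis
  then have "lookup q (ms ! i) = 0" if "i < r" for i
    using that by (metis index_vec index_zero_vec(1) v_def)
  then show "q = 0" using forms_expansion[OF assms(2)] by simp
qed

text \<open>
  Cramer's rule for the square system that replaces a form of degree \<open>s + 1\<close> by a multiple of
  \<open>z\<close>, cleared of the denominator \<open>disc F\<close>.
\<close>

definition reduce :: "'v cpoly \<Rightarrow> 'v cpoly \<Rightarrow> 'v cpoly" where
  "reduce F q = (\<Sum>i<r. cscale (\<Sum>j<r. adj_mat (catal F) $$ (i, j) * pairing F (q * single (ms ! j) 1))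
     (single (ms ! i) 1))"

lemma reduce_in_forms: "reduce F q \<in> forms s"
  unfolding reduce_def
  by (intro cpoly.subspace_sum[OF forms_subspace] cpoly.subspace_scale[OF forms_subspace] forms_single)
    (simp add: mdeg_ms)

lemma lookup_reduce:
  "i < r \<Longrightarrow> lookup (reduce F q) (ms ! i)
    = (\<Sum>j<r. adj_mat (catal F) $$ (i, j) * pairing F (q * single (ms ! j) 1))"
  unfolding reduce_def by (rule lookup_combination_ms)

text \<open>The product of \<open>catal F\<close> with its adjugate is \<open>disc F\<close> times
  the identity. This polynomial identity holds for every F, degenerate ones included.\<close>

lemma pairing_reduce:
  assumes "l < r"
  shows "pairing F (z_power 1 * reduce F q * single (ms ! l) 1)
    = disc F * pairing F (q * single (ms ! l) 1)"
proof -
  define b where "b j = pairing F (q * single (ms ! j) 1)" for j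
  have adj: "adj_mat (catal F) \<in> carrier_mat r r" by (rule adj_mat(1)[OF catal_carrier])
  have prod: "(\<Sum>i<r. catal F $$ (l, i) * adj_mat (catal F) $$ (i, j)) = (if l = j then disc F else 0)"
    if "j < r" for j
  proof -
    have "(\<Sum>i<r. catal F $$ (l, i) * adj_mat (catal F) $$ (i, j)) = (catal F * adj_mat (catal F)) $$ (l, j)"
      using that assms adj catal_carrier[of F] by (auto simp: scalar_prod_def lessThan_atLeast0)
    also have "\<dots> = (if l = j then disc F else 0)"
      using that assms by (simp add: adj_mat(2)[OF catal_carrier] disc_def)
    finally show ?thesis .
  qed
  have "pairing F (z_power 1 * reduce F q * single (ms ! l) 1)
      = (\<Sum>i<r. catal F $$ (l, i) * (\<Sum>j<r. adj_mat (catal F) $$ (i, j) * b j))"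
    unfolding pairing_z_mult[OF reduce_in_forms assms]
    by (intro sum.cong) (auto simp: lookup_reduce b_def)
  also have "\<dots> = (\<Sum>j<r. (\<Sum>i<r. catal F $$ (l, i) * adj_mat (catal F) $$ (i, j)) * b j)"
    unfolding sum_distrib_left sum_distrib_right mult.assoc by (rule sum.swap)
  also have "\<dots> = (\<Sum>j<r. if l = j then disc F * b j else 0)"
    by (intro sum.cong) (auto simp: prod)
  also have "\<dots> = disc F * b l" using assms by simp
  finally show ?thesis by (simp add: b_def)
qed

lemma regular_adj_catal:
  assumes "i < r" "j < r"
  shows "regular (\<lambda>F. adj_mat (catal F) $$ (i, j))"
proof -
  \<comment> \<open>Entries of the cofactor minor with row j and column i deleted: indices from the
    deleted one on are shifted by one.\<close>
  let ?e = "\<lambda>F a b. pairing F (single (single z 1 + ms ! (if a < j then a else Suc a)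
      + ms ! (if b < i then b else Suc b)) 1)"
  have eq: "adj_mat (catal F) $$ (i, j) = (-1) ^ (j + i) * det (mat (r - 1) (r - 1) (\<lambda>(a, b). ?e F a b))" for F
  proof -
    have "mat_delete (catal F) j i = mat (r - 1) (r - 1) (\<lambda>(a, b). ?e F a b)"
      by (rule eq_matI) (use assms in \<open>auto simp: mat_delete_def catal_def\<close>)
    then show ?thesis using assms by (simp add: adj_mat_def cofactor_def catal_def)
  qed
  show ?thesis
    unfolding eq pairing_single by (intro regular_det regular_mult regular_const regular_lookup)
qed

text \<open>The argument \<open>q\<close> may itself depend on F because reductions are iterated:
  the result of one is multiplied by a variable and reduced again.\<close>

lemma regular_reduce:
  assumes "\<And>F. q F \<in> forms (s + 1)" "\<And>m. regular (\<lambda>F. lookup (q F) m)"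
  shows "regular (\<lambda>F. lookup (reduce F (q F)) m)"
proof -
  have "pairing F (q F * single n 1)
      = (\<Sum>m\<in>monomials (s + 1). lookup (q F) m * (lookup F (m + n) * mono_fact (m + n)))" for F n
  proof -
    have "q F = (\<Sum>m\<in>monomials (s + 1). single m (lookup (q F) m))"
      using assms(1)[of F]
      by (intro poly_mapping_sum_single finite_monomials) (auto simp: monomials_def forms_def)
    then have "q F * single n 1 = (\<Sum>m\<in>monomials (s + 1). single m (lookup (q F) m)) * single n 1"
      by (rule arg_cong)
    also have "\<dots> = (\<Sum>m\<in>monomials (s + 1). single (m + n) (lookup (q F) m))"
      by (simp add: sum_distrib_right mult_single)
    finally show ?thesis by (simp add: pairing_sum)
  qed
  note eq = this
  have "regular (\<lambda>F. pairing F (q F * single n 1))" for n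
    unfolding eq by (intro regular_sum regular_mult assms(2) regular_const regular_lookup)
  then show ?thesis
    unfolding reduce_def lookup_sum lookup_cscale
    by (intro regular_sum regular_mult regular_adj_catal regular_const) auto
qed

section \<open>Relations in degree s + 1 and normal forms modulo them\<close>

definition relations :: "'v cpoly \<Rightarrow> 'v cpoly set" where
  "relations F = {w \<in> forms (s + 1). \<forall>j<r. pairing F (w * single (ms ! j) 1) = 0}"

lemma reduce_relation:
  assumes "q \<in> forms (s + 1)"
  shows "cscale (disc F) q - z_power 1 * reduce F q \<in> relations F"
proof -
  have "z_power 1 * reduce F q \<in> forms (1 + s)"
    by (intro forms_mult forms_single reduce_in_forms) simp
  then have "cscale (disc F) q - z_power 1 * reduce F q \<in> forms (s + 1)"
    using assms by (intro cpoly.subspace_diff[OF forms_subspace] cpoly.subspace_scale[OF forms_subspace]) auto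
  moreover have "pairing F ((cscale (disc F) q - z_power 1 * reduce F q) * single (ms ! j) 1) = 0"
    if "j < r" for j
    unfolding left_diff_distrib pairing_diff pairing_reduce[OF that] cscale_mult_left pairing_cscale
    by simp
  ultimately show ?thesis by (simp add: relations_def)
qed

text \<open>Multipliers of degree other than s bring the product into a degree different from that
  of F, where the pairing vanishes; in degree s the defining equations apply.\<close>

lemma relations_subset_Ann:
  assumes "F \<in> forms (2 * s + 1)"
  shows "relations F \<subseteq> Ann F"
proof
  fix w assume w: "w \<in> relations F"
  have "pairing F (w * single c 1) = 0" for c
  proof (cases "mdeg c = s")
    case True
    then have "c \<in> set ms" by (simp add: set_ms monomials_def)
    then obtain j where "j < r" "c = ms ! j" by (auto simp: in_set_conv_nth)
    then show ?thesis using w by (simp add: relations_def)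
  next
    case False
    have "w * single c 1 \<in> forms (s + 1 + mdeg c)"
      using w by (intro forms_mult forms_single) (auto simp: relations_def)
    then show ?thesis by (rule pairing_forms_eq_0[OF assms]) (use False in simp)
  qed
  then show "w \<in> Ann F" by (simp add: Ann_iff_single)
qed

lemma Ann_subset_relations: "Ann F \<inter> forms (s + 1) \<subseteq> relations F"
  by (auto simp: relations_def Ann_iff)

text \<open>
  Reducing one variable at a time writes every monomial of degree \<open>s + k\<close>, up to a power of the
  discriminant, as \<open>z ^ k\<close> times a form of degree \<open>s\<close>, modulo the ideal of the relations.
\<close>

lemma normal_form_exists:
  assumes "mdeg m = s + k"
  shows "\<exists>nf. (\<forall>F. nf F \<in> forms s) \<and> (\<forall>n. regular (\<lambda>F. lookup (nf F) n)) \<and>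
    (\<forall>F I. module.subspace (*) I \<and> relations F \<subseteq> I \<longrightarrow>
       cscale (disc F ^ k) (single m 1) - z_power k * nf F \<in> I)"
  using assms
proof (induction k arbitrary: m)
  case 0
  have "regular (\<lambda>F :: 'v cpoly. lookup (single m 1 :: 'v cpoly) n)" for n by (rule regular_const)
  moreover have "module.subspace (*) I \<Longrightarrow> 0 \<in> I" for I :: "'v cpoly set" by (simp add: ideal_iff)
  ultimately show ?case
    using 0 by (intro exI[of _ "\<lambda>F. single m 1"]) (auto intro: forms_single)
next
  case (Suc k)
  then have "keys m \<noteq> {}" by auto
  then obtain i where "i \<in> keys m" by blast
  define m' where "m' = m - single i 1"
  have m: "m = single i 1 + m'"
    using \<open>i \<in> keys m\<close> unfolding m'_def
    by (auto simp: poly_mapping_eq_iff fun_eq_iff lookup_add lookup_minus lookup_single when_def in_keys_iff)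
  then have "mdeg m' = s + k" using Suc.prems by (simp add: mdeg_add)
  from Suc.IH[OF this] obtain nf where nf: "\<And>F. nf F \<in> forms s" "\<And>n. regular (\<lambda>F. lookup (nf F) n)"
    "\<And>F I. module.subspace (*) I \<Longrightarrow> relations F \<subseteq> I \<Longrightarrow>
       cscale (disc F ^ k) (single m' 1) - z_power k * nf F \<in> I"
    by metis
  let ?y = "single (single i 1) 1 :: 'v cpoly"
  let ?q = "\<lambda>F. ?y * nf F"
  have q: "?q F \<in> forms (s + 1)" for F
    using forms_mult[OF forms_single[of "single i 1" 1 1] nf(1)[of F]] by simp
  have reg: "regular (\<lambda>F. lookup (?q F) n)" for n
    unfolding lookup_single_mult
    by (cases "\<exists>b. n = single i 1 + b") (auto intro: nf(2) regular_const)
  show ?case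
  proof (intro exI[of _ "\<lambda>F. reduce F (?q F)"] conjI allI impI)
    show "regular (\<lambda>F. lookup (reduce F (?q F)) n)" for n by (rule regular_reduce[OF q reg])
  next
    fix F I assume I: "module.subspace (*) I \<and> relations F \<subseteq> I"
    let ?a = "cscale (disc F ^ k) (single m' 1) - z_power k * nf F"
    let ?b = "cscale (disc F) (?q F) - z_power 1 * reduce F (?q F)"
    have zk: "z_power (Suc k) = z_power k * z_power 1" by (simp add: mult_single flip: single_add)
    have xm: "single m 1 = ?y * single m' 1" by (simp add: m mult_single)
    \<comment> \<open>The total error splits in two: the error \<open>?a\<close> of the shorter
      monomial, multiplied by the discriminant and the removed variable, and the error
      \<open>?b\<close> of one more reduction, multiplied by \<open>z_power k\<close>.\<close>
    have "cscale (disc F ^ Suc k) (single m 1) - z_power (Suc k) * reduce F (?q F)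
        = cscale (disc F) ?y * ?a + z_power k * ?b"
      unfolding zk xm
      by (simp add: right_diff_distrib cpoly.scale_right_diff_distrib cscale_mult_left
          cscale_mult_right mult_ac del: cscale_single)
    moreover have "?a \<in> I" using I by (intro nf(3)) auto
    moreover have "?b \<in> I" using subsetD[OF conjunct2[OF I] reduce_relation[OF q]] .
    ultimately show "cscale (disc F ^ Suc k) (single m 1) - z_power (Suc k) * reduce F (?q F) \<in> I"
      using I by (simp add: ideal_iff)
  qed (rule reduce_in_forms)
qed

text \<open>The choice depends on \<open>k\<close> and \<open>m\<close> only and is made for all F
  simultaneously; otherwise regularity in F would be lost.\<close>

definition normal_form :: "nat \<Rightarrow> 'v monom \<Rightarrow> 'v cpoly \<Rightarrow> 'v cpoly" where
  "normal_form k m = (SOME nf. (\<forall>F. nf F \<in> forms s) \<and> (\<forall>n. regular (\<lambda>F. lookup (nf F) n)) \<and>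
    (\<forall>F I. module.subspace (*) I \<and> relations F \<subseteq> I \<longrightarrow>
       cscale (disc F ^ k) (single m 1) - z_power k * nf F \<in> I))"

lemma
  assumes "mdeg m = s + k"
  shows normal_form_in_forms: "normal_form k m F \<in> forms s"
    and regular_normal_form: "regular (\<lambda>F. lookup (normal_form k m F) n)"
    and normal_form_relation: "module.subspace (*) I \<Longrightarrow> relations F \<subseteq> I \<Longrightarrow>
       cscale (disc F ^ k) (single m 1) - z_power k * normal_form k m F \<in> I"
  using someI_ex[OF normal_form_exists[OF assms], folded normal_form_def] by auto

text \<open>The monomials not divisible by \<open>z ^ (k - s)\<close>. For k \<le> s truncated
  subtraction leaves none, in accordance with a Hilbert function that is full in these
  degrees.\<close>

definition pivots :: "nat \<Rightarrow> 'v monom set" where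
  "pivots k = {m \<in> monomials k. lookup m z < k - s}"

text \<open>One element per pivot. When the discriminant is nonzero, these are a linear basis of the
  piece of degree k rather than a set of ideal generators.\<close>

definition generator :: "nat \<Rightarrow> 'v cpoly \<Rightarrow> 'v monom \<Rightarrow> 'v cpoly" where
  "generator k F m = cscale (disc F ^ (k - s)) (single m 1) - z_power (k - s) * normal_form (k - s) m F"

lemma finite_pivots [simp]: "finite (pivots k)"
  unfolding pivots_def by (rule finite_subset[OF _ finite_monomials[of k]]) auto

lemma mdeg_pivot:
  assumes "m \<in> pivots k"
  shows "mdeg m = s + (k - s)" "mdeg m = k" "s \<le> k"
  using assms by (auto simp: pivots_def monomials_def)

lemma generator_in_forms: "m \<in> pivots k \<Longrightarrow> generator k F m \<in> forms k"
proof -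
  assume m: "m \<in> pivots k"
  have "z_power (k - s) * normal_form (k - s) m F \<in> forms (k - s + s)"
    by (intro forms_mult forms_single normal_form_in_forms) (use mdeg_pivot[OF m] in auto)
  then show ?thesis
    unfolding generator_def using mdeg_pivot[OF m]
    by (intro cpoly.subspace_diff[OF forms_subspace] cpoly.subspace_scale[OF forms_subspace] forms_single) auto
qed

lemma regular_generator:
  assumes "m \<in> pivots k"
  shows "regular (\<lambda>F. lookup (generator k F m) n)"
proof -
  have "regular (\<lambda>F. lookup (z_power (k - s) * normal_form (k - s) m F) n)"
    unfolding lookup_single_mult
    by (cases "\<exists>b. n = single z (k - s) + b")
      (auto intro: regular_normal_form[OF mdeg_pivot(1)[OF assms]] regular_const)
  then show ?thesis
    unfolding generator_def lookup_minus lookup_cscale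
    by (intro regular_diff regular_mult regular_power regular_disc regular_const) auto
qed

lemma generator_in_ideal:
  assumes "m \<in> pivots k" "module.subspace (*) I" "relations F \<subseteq> I"
  shows "generator k F m \<in> I"
  unfolding generator_def
  by (rule normal_form_relation[OF mdeg_pivot(1)[OF assms(1)] assms(2,3)])

text \<open>The subtracted part is a multiple of \<open>z_power (k - s)\<close>, hence involves no
  pivot monomial.\<close>

lemma lookup_generator_pivot:
  assumes "m \<in> pivots k" "m' \<in> pivots k"
  shows "lookup (generator k F m) m' = (if m' = m then disc F ^ (k - s) else 0)"
proof -
  have "\<nexists>b. m' = single z (k - s) + b" using assms(2) by (auto simp: pivots_def lookup_add)
  then have "lookup (z_power (k - s) * normal_form (k - s) m F) m' = 0"
    by (simp add: lookup_single_mult)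
  then show ?thesis by (auto simp: generator_def lookup_minus lookup_single when_def)
qed

lemma echelon_generators:
  "disc F \<noteq> 0 \<Longrightarrow> echelon_family (pivots k) (generator k F) (disc F ^ (k - s))"
  by unfold_locales (auto simp: lookup_generator_pivot)

text \<open>For k \<ge> s, multiplication by the power of z matches the monomials of degree s with
  the non-pivots, so there are r of those. The additive form avoids truncated subtraction.\<close>

lemma card_pivots:
  "card (pivots k) + min r (card (monomials k :: 'v monom set)) = card (monomials k :: 'v monom set)"
proof -
  have le: "r \<le> card (monomials k :: 'v monom set)" if "s \<le> k"
    unfolding r_eq using that by (rule card_monomials_mono)
  have ge: "card (monomials k :: 'v monom set) \<le> r" if "k \<le> s"
    unfolding r_eq using that by (rule card_monomials_mono)
  show ?thesis
  proof (cases "s \<le> k")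
    case True
    have bij: "bij_betw (\<lambda>m. single z (k - s) + m) (monomials s) (monomials k - pivots k)"
    proof (rule bij_betw_imageI)
      show "(\<lambda>m. single z (k - s) + m) ` monomials s = monomials k - pivots k"
      proof (intro equalityI subsetI)
        fix m assume "m \<in> monomials k - pivots k"
        then have m: "mdeg m = k" "k - s \<le> lookup m z" by (auto simp: pivots_def monomials_def)
        then have eq: "m = single z (k - s) + (m - single z (k - s))"
          by (auto simp: poly_mapping_eq_iff fun_eq_iff lookup_add lookup_minus lookup_single when_def)
        then have "mdeg m = (k - s) + mdeg (m - single z (k - s))" by (metis mdeg_add mdeg_single)
        then have "mdeg (m - single z (k - s)) = s" using m(1) True by simp
        then show "m \<in> (\<lambda>m. single z (k - s) + m) ` monomials s"
          using eq by (auto simp: monomials_def)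
      qed (use True in \<open>auto simp: pivots_def monomials_def mdeg_add lookup_add\<close>)
    qed (auto intro: inj_onI)
    have "card (monomials k - pivots k) = card (monomials k :: 'v monom set) - card (pivots k)"
      by (rule card_Diff_subset) (auto simp: pivots_def)
    moreover have "card (pivots k) \<le> card (monomials k :: 'v monom set)"
      by (rule card_mono) (auto simp: pivots_def)
    ultimately show ?thesis using bij_betw_same_card[OF bij] le[OF True] r_eq by simp
  next
    case False
    then have "pivots k = {}" by (auto simp: pivots_def)
    then show ?thesis using ge False by simp
  qed
qed

text \<open>Taking a span, not the graded piece of the ideal generated by the relations, secures the
  dimension as soon as the discriminant is nonzero. Compatibility between degrees is then a separate
  question.\<close>

definition ideal_part :: "nat \<Rightarrow> 'v cpoly \<Rightarrow> 'v cpoly set" where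
  "ideal_part k F = cpoly.span (generator k F ` pivots k)"

lemma ideal_part_subset_forms: "ideal_part k F \<subseteq> forms k"
  unfolding ideal_part_def
  by (rule cpoly.span_minimal[OF _ forms_subspace]) (auto intro: generator_in_forms)

lemma ideal_part_subset:
  assumes "module.subspace (*) I" "relations F \<subseteq> I"
  shows "ideal_part k F \<subseteq> I"
  unfolding ideal_part_def
  by (rule cpoly.span_minimal[OF _ ideal_subspace[OF assms(1)]]) (auto intro: generator_in_ideal[OF _ assms])

lemma divide_z_power:
  assumes "u \<in> forms k" "e \<le> k" "\<And>m. lookup m z < e \<Longrightarrow> lookup u m = 0"
  shows "\<exists>q \<in> forms (k - e). u = z_power e * q"
proof -
  have m: "m = single z e + (m - single z e)" if "m \<in> keys u" for m
  proof -
    have "e \<le> lookup m z" using that assms(3)[of m] by (force simp: in_keys_iff)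
    then show ?thesis
      by (auto simp: poly_mapping_eq_iff fun_eq_iff lookup_add lookup_minus lookup_single when_def)
  qed
  define q where "q = (\<Sum>m\<in>keys u. single (m - single z e) (lookup u m))"
  have "u = (\<Sum>m\<in>keys u. single m (lookup u m))"
    by (rule poly_mapping_sum_single) auto
  also have "\<dots> = z_power e * q"
    unfolding q_def sum_distrib_left
  proof (rule sum.cong[OF refl])
    fix n assume "n \<in> keys u"
    from m[OF this] show "single n (lookup u n) = z_power e * single (n - single z e) (lookup u n)"
      by (simp add: mult_single)
  qed
  finally have "u = z_power e * q" .
  moreover have "q \<in> forms (k - e)"
    unfolding q_def
  proof (intro cpoly.subspace_sum[OF forms_subspace] forms_single)
    fix n assume n: "n \<in> keys u"
    then have "mdeg n = k" using assms(1) by (simp add: forms_def)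
    moreover have "mdeg n = e + mdeg (n - single z e)" using m[OF n] by (metis mdeg_add mdeg_single)
    ultimately show "mdeg (n - single z e) = k - e" by simp
  qed
  ultimately show ?thesis by blast
qed

text \<open>Division with remainder: clearing all pivot coefficients leaves only monomials divisible
  by \<open>z_power (k - s)\<close>, and the quotient lands in degree s, where nondegeneracy can be
  applied.\<close>

lemma reduction_modulo_generators:
  assumes "v \<in> forms k" "s \<le> k" "disc F \<noteq> 0"
  shows "\<exists>q \<in> forms s. cscale (disc F ^ (k - s)) v
    - (\<Sum>m\<in>pivots k. cscale (lookup v m) (generator k F m)) = z_power (k - s) * q"
proof -
  interpret echelon_family "pivots k" "generator k F" "disc F ^ (k - s)"
    by (rule echelon_generators[OF assms(3)])
  let ?u = "cscale (disc F ^ (k - s)) v - (\<Sum>m\<in>pivots k. cscale (lookup v m) (generator k F m))"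
  have u: "?u \<in> forms k"
    by (intro cpoly.subspace_diff[OF forms_subspace] cpoly.subspace_sum[OF forms_subspace]
        cpoly.subspace_scale[OF forms_subspace] generator_in_forms assms(1))
  have "lookup ?u m = 0" if "lookup m z < k - s" for m
  proof (cases "mdeg m = k")
    case True
    then have "m \<in> pivots k" using that by (simp add: pivots_def monomials_def)
    then show ?thesis
      using lookup_combination[of m "lookup v"] unfolding lookup_minus lookup_cscale by simp
  next
    case False
    then show ?thesis by (rule u[unfolded forms_lookup, rule_format])
  qed
  then have "\<exists>q\<in>forms (k - (k - s)). ?u = z_power (k - s) * q"
    by (intro divide_z_power[OF u]) auto
  moreover have "k - (k - s) = s" using assms(2) by simp
  ultimately show ?thesis by (simp only:)
qed

text \<open>The remainder is z q with q of degree s and is again a relation, because the generators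
  of degree s + 1 are relations too; \<open>nondegenerate\<close> then forces q = 0.\<close>

lemma relations_subset_ideal_part:
  assumes "disc F \<noteq> 0" "F \<in> forms (2 * s + 1)"
  shows "relations F \<subseteq> ideal_part (s + 1) F"
proof
  interpret echelon_family "pivots (s + 1)" "generator (s + 1) F" "disc F ^ (s + 1 - s)"
    by (rule echelon_generators[OF assms(1)])
  fix v assume v: "v \<in> relations F"
  have sub: "cpoly.subspace (relations F)"
    by (rule cpoly.subspaceI)
      (auto simp: relations_def forms_lookup lookup_add distrib_right pairing_add cscale_mult_left pairing_cscale)
  let ?u = "cscale (disc F ^ (s + 1 - s)) v - (\<Sum>m\<in>pivots (s + 1). cscale (lookup v m) (generator (s + 1) F m))"
  obtain q where q: "q \<in> forms s" "?u = z_power 1 * q"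
    using reduction_modulo_generators[of v "s + 1" F] v assms by (auto simp: relations_def)
  have "generator (s + 1) F m \<in> relations F" if m: "m \<in> pivots (s + 1)" for m
    using generator_in_ideal[OF m ideal_Ann relations_subset_Ann[OF assms(2)]]
      generator_in_forms[OF m] Ann_subset_relations by (meson IntI subsetD)
  then have "?u \<in> relations F"
    using v by (intro cpoly.subspace_diff[OF sub] cpoly.subspace_sum[OF sub] cpoly.subspace_scale[OF sub])
  then have "q = 0"
    using q nondegenerate[OF assms(1) q(1)] by (simp add: relations_def)
  then show "v \<in> ideal_part (s + 1) F"
    unfolding ideal_part_def in_span_w_iff using q(2) by simp
qed

end


section \<open>Uniqueness of the apolar ideal\<close>

lemma homogeneous_ideal_mem_iff:
  assumes "homogeneous_ideal I"
  shows "p \<in> I \<longleftrightarrow> (\<forall>k. hom_component k p \<in> I \<inter> forms k)"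
proof
  assume "\<forall>k. hom_component k p \<in> I \<inter> forms k"
  moreover have "cpoly.subspace I" using assms by (auto simp: homogeneous_ideal_def intro: ideal_subspace)
  ultimately have "(\<Sum>k\<in>mdeg ` keys p. hom_component k p) \<in> I"
    by (intro cpoly.subspace_sum) auto
  then show "p \<in> I" using sum_hom_components[of p] by simp
qed (use assms in \<open>auto simp: homogeneous_ideal_def hom_component_in_forms\<close>)

context catalecticant
begin

text \<open>A priori only a graded subspace; stability under multiplication is established
  separately for F in the secant variety.\<close>

definition apolar_ideal :: "'v cpoly \<Rightarrow> 'v cpoly set" where
  "apolar_ideal F = {p. \<forall>k. hom_component k p \<in> ideal_part k F}"

lemma zero_in_ideal_part [simp]: "0 \<in> ideal_part k F"
  by (simp add: ideal_part_def cpoly.span_zero)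

lemma apolar_ideal_Int_forms: "apolar_ideal F \<inter> forms k = ideal_part k F"
proof (intro equalityI subsetI)
  fix p assume "p \<in> apolar_ideal F \<inter> forms k"
  then have "hom_component k p \<in> ideal_part k F" "p \<in> forms k" by (auto simp: apolar_ideal_def)
  then show "p \<in> ideal_part k F" by (simp add: hom_component_forms)
next
  fix p assume p: "p \<in> ideal_part k F"
  then have "p \<in> forms k" using ideal_part_subset_forms by (rule subsetD[rotated])
  then show "p \<in> apolar_ideal F \<inter> forms k" using p by (auto simp: apolar_ideal_def hom_component_forms)
qed

lemma apolar_ideal_eqI:
  assumes "homogeneous_ideal J" "\<And>k. J \<inter> forms k = ideal_part k F"
  shows "J = apolar_ideal F"
proof (rule Set.set_eqI)
  fix p
  show "p \<in> J \<longleftrightarrow> p \<in> apolar_ideal F"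
    unfolding homogeneous_ideal_mem_iff[OF assms(1), of p] assms(2) by (simp add: apolar_ideal_def)
qed

lemma dim_ideal_part:
  "disc F \<noteq> 0 \<Longrightarrow> cpoly.dim (ideal_part k F) = card (pivots k)"
  unfolding ideal_part_def by (rule echelon_family.dim_span_w[OF echelon_generators])

lemma apolar_ideal_in_hilb:
  assumes "disc F \<noteq> 0" "homogeneous_ideal (apolar_ideal F)"
  shows "apolar_ideal F \<in> hilb r"
proof -
  have "card (monomials k :: 'v monom set) - card (pivots k)
      = min r (card (monomials k :: 'v monom set))" for k
    using card_pivots[of k] by linarith
  then show ?thesis
    using assms
    by (simp add: hilb_def hilbert_function_def apolar_ideal_Int_forms dim_ideal_part dim_forms)
qed

lemma apolar_ideal_subset_Ann:
  assumes "F \<in> forms (2 * s + 1)"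
  shows "apolar_ideal F \<subseteq> Ann F"
proof
  fix p assume p: "p \<in> apolar_ideal F"
  have "p = (\<Sum>k\<in>mdeg ` keys p. hom_component k p)" by (rule sum_hom_components)
  also have "\<dots> \<in> Ann F"
  proof (rule cpoly.subspace_sum[OF ideal_subspace[OF ideal_Ann]])
    fix k
    have "hom_component k p \<in> ideal_part k F" using p by (simp add: apolar_ideal_def)
    then show "hom_component k p \<in> Ann F"
      using ideal_part_subset[OF ideal_Ann relations_subset_Ann[OF assms]] by (rule subsetD[rotated])
  qed
  finally show "p \<in> Ann F" .
qed

text \<open>In degree s + 1 the inclusion into Ann F places J inside
  \<open>ideal_part (s + 1) F\<close>, and equal dimensions make them coincide, so J contains all
  relations. Then J contains every generator, and dimensions agree in each degree.\<close>

lemma hilb_subset_Ann_unique: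
  assumes F: "F \<in> forms (2 * s + 1)" "disc F \<noteq> 0"
    and J: "J \<in> hilb r" "J \<subseteq> Ann F"
  shows "J = apolar_ideal F"
proof (rule apolar_ideal_eqI)
  show hom: "homogeneous_ideal J" using J(1) by (simp add: hilb_def)
  then have idl: "module.subspace (*) J" by (simp add: homogeneous_ideal_def)
  have sub: "cpoly.subspace (J \<inter> forms k)" for k
    by (rule cpoly.subspace_inter[OF ideal_subspace[OF idl] forms_subspace])
  have dim: "cpoly.dim (J \<inter> forms k) = card (pivots k)" for k
  proof -
    have "card (monomials k :: 'v monom set) - cpoly.dim (J \<inter> forms k)
        = min r (card (monomials k :: 'v monom set))"
      using J(1) by (simp add: hilb_def hilbert_function_def dim_forms)
    \<comment> \<open>The Hilbert function is a truncated difference; its value determines the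
      dimension of the piece of J because it is positive.\<close>
    moreover have "min r (card (monomials k :: 'v monom set)) > 0"
      using r_pos card_monomials_pos[where 'v = 'v] by simp
    ultimately show ?thesis using card_pivots[of k] by linarith
  qed
  have "J \<inter> forms (s + 1) \<subseteq> ideal_part (s + 1) F"
    using J(2) Ann_subset_relations relations_subset_ideal_part[OF F(2,1)] by auto
  then have "ideal_part (s + 1) F \<subseteq> J \<inter> forms (s + 1)"
    unfolding ideal_part_def
    by (intro span_subset_of_dim_ge sub) (auto simp: dim card_image_le)
  then have rel: "relations F \<subseteq> J" using relations_subset_ideal_part[OF F(2,1)] by auto
  show "J \<inter> forms k = ideal_part k F" for k
  proof
    interpret echelon_family "pivots k" "generator k F" "disc F ^ (k - s)"
      by (rule echelon_generators[OF F(2)])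
    show 1: "ideal_part k F \<subseteq> J \<inter> forms k"
      using ideal_part_subset[OF idl rel] ideal_part_subset_forms by auto
    have "generator k F ` pivots k \<subseteq> J \<inter> forms k"
      using cpoly.span_superset 1 unfolding ideal_part_def by (rule subset_trans)
    moreover have "J \<inter> forms k \<subseteq> cpoly.span ((\<lambda>m. single m 1) ` monomials k)"
      by (simp flip: forms_eq_span)
    ultimately show "J \<inter> forms k \<subseteq> ideal_part k F"
      unfolding ideal_part_def
      by (intro subset_span_of_dim_le[OF independent_w]) (auto simp: dim card_image[OF inj_w])
  qed
qed

text \<open>By linearity and induction on the degree of the multiplier, it is enough to multiply
  generators by single variables. In each degree this leaves finitely many membership
  conditions.\<close>

lemma homogeneous_apolar_ideal:
  assumes shift: "\<And>i k m. m \<in> pivots k \<Longrightarrow> single (single i 1) 1 * generator k F m \<in> ideal_part (Suc k) F"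
  shows "homogeneous_ideal (apolar_ideal F)"
proof -
  have sub: "cpoly.subspace (ideal_part k F)" for k by (simp add: ideal_part_def)
  have var: "single (single i 1) 1 * p \<in> ideal_part (Suc k) F" if "p \<in> ideal_part k F" for i k p
    using that[unfolded ideal_part_def]
  proof (induction rule: cpoly.span_induct)
    case base
    show ?case
      by (rule cpoly.subspaceI)
        (auto simp: distrib_left cscale_mult_right cpoly.subspace_add[OF sub] cpoly.subspace_scale[OF sub])
  qed (use shift in auto)
  have mono: "single m 1 * p \<in> ideal_part (n + k) F" if "p \<in> ideal_part k F" "mdeg m = n" for m k p n
    using that
  proof (induction n arbitrary: m)
    case (Suc n)
    then have "keys m \<noteq> {}" by auto
    then obtain i where "i \<in> keys m" by blast
    then have m: "m = single i 1 + (m - single i 1)"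
      by (auto simp: poly_mapping_eq_iff fun_eq_iff lookup_add lookup_minus lookup_single when_def in_keys_iff)
    then have "mdeg m = 1 + mdeg (m - single i 1)" by (metis mdeg_add mdeg_single)
    then have "single (m - single i 1) 1 * p \<in> ideal_part (n + k) F" using Suc by simp
    from var[OF this, of i] have "single (single i 1 + (m - single i 1)) 1 * p \<in> ideal_part (Suc (n + k)) F"
      by (simp add: mult_single flip: mult.assoc)
    then show ?case unfolding m[symmetric] by simp
  qed simp
  have mult: "q * p \<in> apolar_ideal F" if p: "p \<in> apolar_ideal F" for q p
  proof (induction q rule: poly_mapping_additive_induct)
    case (single m c)
    have "hom_component k (single m c * p) \<in> ideal_part k F" for k
    proof (cases "mdeg m \<le> k")
      case True
      have "hom_component (k - mdeg m) p \<in> ideal_part (k - mdeg m) F" using p by (simp add: apolar_ideal_def)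
      from mono[OF this refl, of m] have "single m 1 * hom_component (k - mdeg m) p \<in> ideal_part k F"
        using True by simp
      then have "cscale c (single m 1 * hom_component (k - mdeg m) p) \<in> ideal_part k F"
        by (rule cpoly.subspace_scale[OF sub])
      then show ?thesis using True by (simp add: hom_component_single_mult flip: cscale_mult_left)
    qed (simp add: hom_component_single_mult)
    then show ?case by (simp add: apolar_ideal_def)
  qed (auto simp: apolar_ideal_def distrib_right hom_component_add cpoly.subspace_add[OF sub])
  have "hom_component k p \<in> apolar_ideal F" if p: "p \<in> apolar_ideal F" for k p
    using p by (auto simp: apolar_ideal_def hom_component_forms[OF hom_component_in_forms])
  moreover have "module.subspace (*) (apolar_ideal F)"
    unfolding ideal_iff
    using mult by (auto simp: apolar_ideal_def hom_component_add cpoly.subspace_add[OF sub])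
  ultimately show ?thesis by (simp add: homogeneous_ideal_def)
qed

text \<open>
  The obstructions to \<open>apolar_ideal F\<close> being an ideal are regular in \<open>F\<close>, so they vanish
  on a secant variety as soon as they vanish on the forms of the corresponding rank.
\<close>

definition obstruction :: "'v \<Rightarrow> nat \<Rightarrow> 'v monom \<Rightarrow> 'v cpoly \<Rightarrow> 'v cpoly" where
  "obstruction i k m F = (let v = single (single i 1) 1 * generator k F m in
     cscale (disc F ^ (Suc k - s)) v
       - (\<Sum>m'\<in>pivots (Suc k). cscale (lookup v m') (generator (Suc k) F m')))"

lemma obstruction_eq_0_iff:
  assumes "disc F \<noteq> 0"
  shows "obstruction i k m F = 0 \<longleftrightarrow> single (single i 1) 1 * generator k F m \<in> ideal_part (Suc k) F"
  unfolding obstruction_def Let_def ideal_part_def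
    echelon_family.in_span_w_iff[OF echelon_generators[OF assms]] ..

lemma regular_obstruction:
  assumes "m \<in> pivots k"
  shows "regular (\<lambda>F. lookup (obstruction i k m F) n)"
proof -
  have v: "regular (\<lambda>F. lookup (single (single i 1) 1 * generator k F m) n)" for n
    unfolding lookup_single_mult
    by (cases "\<exists>b. n = single i 1 + b") (auto intro: regular_generator[OF assms] regular_const)
  show ?thesis
    unfolding obstruction_def Let_def lookup_minus lookup_sum lookup_cscale
    by (intro regular_diff regular_mult regular_power regular_disc regular_sum v regular_generator)
qed

end


section \<open>Ideals of points\<close>

lemma eval_at_mult: "eval_at l (p * q) = eval_at l p * eval_at l q"
  by (simp add: eval_at_def poly_eval_mult)

lemma eval_at_cscale_point: "eval_at (cscale t l) p = poly_eval (\<lambda>i. t * lookup l (single i 1)) p"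
  by (simp add: eval_at_def)

lemma vanishing_ideal_iff:
  "f \<in> vanishing_ideal (pt ` L) \<longleftrightarrow> (\<forall>l\<in>L. \<forall>t. eval_at (cscale t l) f = 0)"
  by (auto simp: vanishing_ideal_def pt_def cpoly.span_singleton eval_at_def)

lemma vanishing_ideal_forms_iff:
  assumes "f \<in> forms k"
  shows "f \<in> vanishing_ideal (pt ` L) \<longleftrightarrow> (\<forall>l\<in>L. eval_at l f = 0)"
proof -
  have "(\<forall>t. eval_at (cscale t l) f = 0) \<longleftrightarrow> eval_at l f = 0" for l
  proof
    assume "\<forall>t. eval_at (cscale t l) f = 0"
    from spec[OF this, of 1] show "eval_at l f = 0" by simp
  qed (simp add: eval_at_cscale_point poly_eval_forms_scale[OF assms] eval_at_def)
  then show ?thesis by (simp add: vanishing_ideal_iff)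
qed

text \<open>A component that is nonzero at \<open>l\<close> would make \<open>f\<close> nonzero at
  some multiple of \<open>l\<close>, which represents the same point.\<close>

lemma homogeneous_vanishing_ideal: "homogeneous_ideal (vanishing_ideal (pt ` L))"
  unfolding homogeneous_ideal_def
proof (intro conjI ballI allI)
  show "module.subspace (*) (vanishing_ideal (pt ` L))"
    unfolding ideal_iff by (auto simp: vanishing_ideal_iff eval_at_def poly_eval_add poly_eval_mult)
  fix f k assume f: "f \<in> vanishing_ideal (pt ` L)"
  have "eval_at l (hom_component k f) = 0" if "l \<in> L" for l
  proof (rule ccontr)
    assume "eval_at l (hom_component k f) \<noteq> 0"
    from poly_eval_scaled_nonzero[OF this[unfolded eval_at_def]]
    obtain t where "eval_at (cscale t l) f \<noteq> 0" unfolding eval_at_cscale_point by blast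
    then show False using f that by (simp add: vanishing_ideal_iff)
  qed
  then show "hom_component k f \<in> vanishing_ideal (pt ` L)"
    by (simp add: vanishing_ideal_forms_iff[OF hom_component_in_forms])
qed

context catalecticant
begin

text \<open>The generalised Vandermonde matrix; it is invertible exactly when the r points impose
  independent conditions on forms of degree s.\<close>

definition vander :: "(nat \<Rightarrow> 'v cpoly) \<Rightarrow> complex mat" where
  "vander l = mat r r (\<lambda>(j, i). eval_at (l j) (single (ms ! i) 1))"

lemma vander_carrier: "vander l \<in> carrier_mat r r"
  by (simp add: vander_def)

abbreviation z_coord :: "'v cpoly \<Rightarrow> complex" where
  "z_coord l \<equiv> lookup l (single z 1)"

lemma eval_at_z_power: "eval_at l (z_power k) = z_coord l ^ k"
  by (simp add: eval_at_def)

text \<open>The Gram matrix factors as the transpose of V times E times V, with V =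
  \<open>vander l\<close> and E diagonal with entries
  \<open>fact (2 * s + 1) * c j * z_coord (l j)\<close>.\<close>

lemma disc_power_sum_form:
  assumes "\<And>j. j < r \<Longrightarrow> l j \<in> forms 1"
  shows "disc (power_sum_form (2 * s + 1) r c l) \<noteq> 0
    \<longleftrightarrow> det (vander l) \<noteq> 0 \<and> (\<forall>j<r. c j \<noteq> 0 \<and> z_coord (l j) \<noteq> 0)"
proof -
  let ?F = "power_sum_form (2 * s + 1) r c l"
  define K :: complex where "K = fact (2 * s + 1)"
  have K: "K \<noteq> 0" unfolding K_def by (rule fact_nonzero)
  let ?e = "\<lambda>j. K * (c j * z_coord (l j))"
  define E where "E = mat r r (\<lambda>(i, j). if i = j then ?e i else 0)"
  have E: "E \<in> carrier_mat r r" by (simp add: E_def)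
  have EV: "(E * vander l) $$ (j, b) = ?e j * vander l $$ (j, b)" if "j < r" "b < r" for j b
  proof -
    have "(E * vander l) $$ (j, b) = (\<Sum>i<r. E $$ (j, i) * vander l $$ (i, b))"
      using that E by (simp add: vander_def scalar_prod_def lessThan_atLeast0)
    also have "\<dots> = (\<Sum>i<r. if i = j then ?e i * vander l $$ (i, b) else 0)"
      using that by (intro sum.cong) (auto simp: E_def)
    finally show ?thesis using that by simp
  qed
  have "catal ?F = transpose_mat (vander l) * (E * vander l)"
  proof (rule eq_matI)
    fix a b assume "a < dim_row (transpose_mat (vander l) * (E * vander l))"
      "b < dim_col (transpose_mat (vander l) * (E * vander l))"
    then have ab: "a < r" "b < r" by (auto simp: vander_def)
    have deg: "single (single z 1 + ms ! a + ms ! b) 1 \<in> forms (2 * s + 1)"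
      using ab by (intro forms_single) (simp add: mdeg_add mdeg_ms)
    have "catal ?F $$ (a, b) = K * (\<Sum>j<r. c j *
        eval_at (l j) (single (single z 1 + ms ! a + ms ! b) 1))"
      using ab by (simp only: catal_def index_mat split_conv pairing_power_sum_form[OF assms deg] K_def)
    also have "\<dots> = (\<Sum>j<r. vander l $$ (j, a) * (?e j * vander l $$ (j, b)))"
      unfolding sum_distrib_left using ab
      by (intro sum.cong) (auto simp: vander_def eval_at_def mono_eval_add)
    also have "\<dots> = (\<Sum>j<r. vander l $$ (j, a) * (E * vander l) $$ (j, b))"
      using ab by (intro sum.cong) (auto simp: EV)
    also have "\<dots> = (transpose_mat (vander l) * (E * vander l)) $$ (a, b)"
      using ab E by (simp add: vander_def scalar_prod_def lessThan_atLeast0 del: index_mult_mat(1))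
        (simp add: scalar_prod_def)
    finally show "catal ?F $$ (a, b) = (transpose_mat (vander l) * (E * vander l)) $$ (a, b)" .
  qed (auto simp: catal_def vander_def E_def)
  then have "disc ?F = det (vander l) * (det E * det (vander l))"
    unfolding disc_def using vander_carrier E
    by (simp add: det_mult[of _ r] det_transpose[of _ r])
  moreover have "det E = (\<Prod>j = 0..<r. ?e j)"
  proof -
    have "det E = prod_list (diag_mat E)" by (rule det_upper_triangular[OF _ E]) (auto simp: E_def)
    then show ?thesis by (simp add: prod_list_diag_prod E_def)
  qed
  moreover have "(\<Prod>j = 0..<r. ?e j) \<noteq> 0 \<longleftrightarrow> (\<forall>j<r. c j \<noteq> 0 \<and> z_coord (l j) \<noteq> 0)" using K by auto
  ultimately show ?thesis by auto
qed

lemma vander_columns: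
  assumes "det (vander l) \<noteq> 0" "q \<in> forms s" "\<And>j. j < r \<Longrightarrow> eval_at (l j) q = 0"
  shows "q = 0"
proof -
  define v where "v = vec r (\<lambda>i. lookup q (ms ! i))"
  have "vander l *\<^sub>v v = 0\<^sub>v r"
  proof (rule eq_vecI)
    fix j assume "j < dim_vec (0\<^sub>v r :: complex vec)"
    then have j: "j < r" by simp
    have "eval_at (l j) q = (\<Sum>i<r. lookup q (ms ! i) * eval_at (l j) (single (ms ! i) 1))"
      by (subst forms_expansion[OF assms(2)]) (simp add: eval_at_def poly_eval_sum poly_eval_cscale del: cscale_single)
    also have "\<dots> = (vander l *\<^sub>v v) $ j"
      using j by (simp add: vander_def v_def scalar_prod_def lessThan_atLeast0 mult.commute)
    finally show "(vander l *\<^sub>v v) $ j = 0\<^sub>v r $ j" using assms(3)[OF j] j by simp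
  qed (simp add: vander_def)
  moreover have "v \<in> carrier_vec r" by (simp add: v_def)
  ultimately have "v = 0\<^sub>v r"
    using assms(1) unfolding det_0_iff_vec_prod_zero[OF vander_carrier] by metis
  then have "lookup q (ms ! i) = 0" if "i < r" for i
    using that by (metis index_vec index_zero_vec(1) v_def)
  then show "q = 0" using forms_expansion[OF assms(2)] by simp
qed

lemma vander_rows:
  assumes "det (vander l) \<noteq> 0" "\<And>i. i < r \<Longrightarrow> (\<Sum>j<r. u j * eval_at (l j) (single (ms ! i) 1)) = 0"
    and "j < r"
  shows "u j = 0"
proof -
  define v where "v = vec r u"
  have carrier: "transpose_mat (vander l) \<in> carrier_mat r r" by (simp add: vander_def)
  have "transpose_mat (vander l) *\<^sub>v v = 0\<^sub>v r"
  proof (rule eq_vecI)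
    fix i assume "i < dim_vec (0\<^sub>v r :: complex vec)"
    then have i: "i < r" by simp
    have "(transpose_mat (vander l) *\<^sub>v v) $ i = (\<Sum>j<r. u j * eval_at (l j) (single (ms ! i) 1))"
      using i by (simp add: vander_def v_def scalar_prod_def lessThan_atLeast0 mult.commute)
    then show "(transpose_mat (vander l) *\<^sub>v v) $ i = 0\<^sub>v r $ i" using assms(2)[OF i] i by simp
  qed (simp add: vander_def)
  moreover have "v \<in> carrier_vec r" by (simp add: v_def)
  moreover have "det (transpose_mat (vander l)) \<noteq> 0"
    using assms(1) by (simp add: det_transpose[OF vander_carrier])
  ultimately have "v = 0\<^sub>v r"
    unfolding det_0_iff_vec_prod_zero[OF carrier] by metis
  then show "u j = 0" using assms(3) by (metis index_vec index_zero_vec(1) v_def)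
qed

lemma vander_points_distinct:
  assumes "det (vander l) \<noteq> 0" "\<And>j. j < r \<Longrightarrow> l j \<noteq> 0"
  shows "inj_on (\<lambda>j. pt (l j)) {..<r}"
proof (rule inj_onI, rule ccontr)
  fix i j assume ij: "i \<in> {..<r}" "j \<in> {..<r}" "pt (l i) = pt (l j)" "i \<noteq> j"
  then obtain t where t: "l i = cscale t (l j)" using pt_eqD[of "l i" "l j"] assms(2) by auto
  \<comment> \<open>If \<open>l i\<close> is t times \<open>l j\<close>, evaluation of forms of
    degree s at the two differs by \<open>t ^ s\<close>; \<open>u\<close> records this dependence
    between two rows.\<close>
  define u where "u k = (if k = i then 1 else 0) - (if k = j then t ^ s else 0)" for k
  have "u i = 0"
  proof (rule vander_rows[OF assms(1)])
    fix a assume a: "a < r"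
    have "(\<Sum>k<r. u k * eval_at (l k) (single (ms ! a) 1))
        = (\<Sum>k<r. if k = i then eval_at (l k) (single (ms ! a) 1) else 0)
        - (\<Sum>k<r. if k = j then t ^ s * eval_at (l k) (single (ms ! a) 1) else 0)"
      unfolding sum_subtractf[symmetric] by (intro sum.cong) (auto simp: u_def left_diff_distrib)
    also have "\<dots> = eval_at (l i) (single (ms ! a) 1) - t ^ s * eval_at (l j) (single (ms ! a) 1)"
      using ij by simp
    also have "\<dots> = 0"
      unfolding t eval_at_cscale_point
      by (simp add: eval_at_def mono_eval_scale mdeg_ms[OF a])
    finally show "(\<Sum>k<r. u k * eval_at (l k) (single (ms ! a) 1)) = 0" .
  qed (use ij in simp)
  then show False using ij by (simp add: u_def)
qed

text \<open>Relations vanish at the points because evaluations in degree s are independent and no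
  \<open>c j\<close> is 0. Conversely, the remainder of a form vanishing at the points is a power of
  z times some q; as z vanishes at none of them, q vanishes at all r points and is 0.\<close>

lemma apolar_ideal_power_sum_form:
  assumes l: "\<And>j. j < r \<Longrightarrow> l j \<in> forms 1"
    and disc: "disc (power_sum_form (2 * s + 1) r c l) \<noteq> 0"
  shows "vanishing_ideal (pt ` l ` {..<r}) = apolar_ideal (power_sum_form (2 * s + 1) r c l)"
proof (rule apolar_ideal_eqI[OF homogeneous_vanishing_ideal])
  let ?F = "power_sum_form (2 * s + 1) r c l"
  let ?I = "vanishing_ideal (pt ` l ` {..<r})"
  have V: "det (vander l) \<noteq> 0" and c: "\<And>j. j < r \<Longrightarrow> c j \<noteq> 0"
    and zl: "\<And>j. j < r \<Longrightarrow> z_coord (l j) \<noteq> 0"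
    using iffD1[OF disc_power_sum_form[OF l] disc] by auto
  have ideal: "module.subspace (*) ?I"
    using homogeneous_vanishing_ideal[of "l ` {..<r}"] by (simp add: homogeneous_ideal_def)
  have rel: "relations ?F \<subseteq> ?I"
  proof
    fix w assume w: "w \<in> relations ?F"
    then have wf: "w \<in> forms (s + 1)" by (simp add: relations_def)
    have "c j * eval_at (l j) w = 0" if "j < r" for j
    proof (rule vander_rows[OF V _ that])
      fix i assume i: "i < r"
      have deg: "w * single (ms ! i) 1 \<in> forms (2 * s + 1)"
        using forms_mult[OF wf forms_single[OF mdeg_ms[OF i], of 1]] by (simp add: mult_2)
      have "fact (2 * s + 1) * (\<Sum>j<r. c j * eval_at (l j) (w * single (ms ! i) 1))
          = pairing ?F (w * single (ms ! i) 1)"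
        by (rule pairing_power_sum_form[OF l deg, symmetric])
      also have "\<dots> = 0" using w i unfolding relations_def by blast
      finally show "(\<Sum>j<r. c j * eval_at (l j) w * eval_at (l j) (single (ms ! i) 1)) = 0"
        by (simp only: mult_eq_0_iff fact_nonzero simp_thms eval_at_mult mult.assoc)
    qed
    then have "\<forall>p\<in>l ` {..<r}. eval_at p w = 0" using c by simp
    then show "w \<in> ?I" by (rule vanishing_ideal_forms_iff[OF wf, THEN iffD2])
  qed
  show "?I \<inter> forms k = ideal_part k ?F" for k
  proof
    show sub: "ideal_part k ?F \<subseteq> ?I \<inter> forms k"
      using ideal_part_subset[OF ideal rel] ideal_part_subset_forms by auto
    show "?I \<inter> forms k \<subseteq> ideal_part k ?F"
    proof
      fix v assume "v \<in> ?I \<inter> forms k"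
      then have v: "v \<in> ?I" "v \<in> forms k" by auto
      have lv: "eval_at (l j) v = 0" if "j < r" for j
        using vanishing_ideal_forms_iff[OF v(2), THEN iffD1, OF v(1)] that by simp
      show "v \<in> ideal_part k ?F"
      proof (cases "s \<le> k")
        case True
        interpret echelon_family "pivots k" "generator k ?F" "disc ?F ^ (k - s)"
          by (rule echelon_generators[OF disc])
        let ?u = "cscale (disc ?F ^ (k - s)) v - (\<Sum>m\<in>pivots k. cscale (lookup v m) (generator k ?F m))"
        obtain q where q: "q \<in> forms s" "?u = z_power (k - s) * q"
          using reduction_modulo_generators[OF v(2) True disc] by blast
        have "?u \<in> ?I"
          by (intro cpoly.subspace_diff[OF ideal_subspace[OF ideal]]
              cpoly.subspace_sum[OF ideal_subspace[OF ideal]]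
              cpoly.subspace_scale[OF ideal_subspace[OF ideal]] v(1) generator_in_ideal[OF _ ideal rel])
        then have u: "z_power (k - s) * q \<in> ?I" using q(2) by simp
        have uf: "z_power (k - s) * q \<in> forms (k - s + s)"
          by (intro forms_mult forms_single q(1)) simp
        have "eval_at (l j) (z_power (k - s) * q) = 0" if "j < r" for j
          using vanishing_ideal_forms_iff[OF uf, THEN iffD1, OF u] that by simp
        then have "eval_at (l j) q = 0" if "j < r" for j
          using that zl by (simp add: eval_at_mult eval_at_z_power)
        then have "q = 0" by (rule vander_columns[OF V q(1)])
        then show ?thesis unfolding ideal_part_def in_span_w_iff using q(2) by simp
      next
        case False
        \<comment> \<open>Below degree s there are no pivots, so v itself must be 0: multiplying by
          a power of z moves it to degree s, where interpolation is unique.\<close>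
        have "z_power (s - k) * v = 0"
        proof (rule vander_columns[OF V])
          show "z_power (s - k) * v \<in> forms s"
            using forms_mult[OF forms_single[of "single z (s - k)" "s - k" 1] v(2)] False by simp
        qed (simp add: eval_at_mult lv)
        then have "lookup v m = 0" for m
          using lookup_single_mult_add[of "single z (s - k)" 1 v m] by simp
        then have "v = 0" by (intro poly_mapping_eqI) simp
        then show ?thesis by simp
      qed
    qed
  qed
qed

lemma apolar_ideal_of_points:
  assumes l: "\<And>j. j < r \<Longrightarrow> l j \<in> forms 1"
    and disc: "disc (power_sum_form (2 * s + 1) r c l) \<noteq> 0"
  shows "apolar_ideal (power_sum_form (2 * s + 1) r c l)
    \<in> {I \<in> hilb r. \<exists>\<Gamma> \<subseteq> proj_forms 1. finite \<Gamma> \<and> card \<Gamma> = r \<and> I = vanishing_ideal \<Gamma>}"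
proof -
  let ?\<Gamma> = "pt ` l ` {..<r}"
  have V: "det (vander l) \<noteq> 0" and zl: "\<And>j. j < r \<Longrightarrow> z_coord (l j) \<noteq> 0"
    using iffD1[OF disc_power_sum_form[OF l] disc] by auto
  have nz: "l j \<noteq> 0" if "j < r" for j using zl[OF that] by auto
  have eq: "vanishing_ideal ?\<Gamma> = apolar_ideal (power_sum_form (2 * s + 1) r c l)"
    by (rule apolar_ideal_power_sum_form[OF l disc])
  have "card ?\<Gamma> = r"
    unfolding image_image using card_image[OF vander_points_distinct[OF V nz]] by simp
  moreover have "?\<Gamma> \<subseteq> proj_forms 1" using l nz by (auto simp: proj_forms_def)
  moreover have "apolar_ideal (power_sum_form (2 * s + 1) r c l) \<in> hilb r"
    by (rule apolar_ideal_in_hilb[OF disc]) (use homogeneous_vanishing_ideal[of "l ` {..<r}"] eq in simp)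
  ultimately show ?thesis
    using eq[symmetric] by (intro CollectI conjI exI[of _ ?\<Gamma>]) simp_all
qed

end


section \<open>Pluecker coordinates\<close>

lemma is_basis_length: "is_basis bs V \<Longrightarrow> length bs = cpoly.dim V"
  by (auto simp: is_basis_def distinct_card cpoly.dim_eq_card_independent)

text \<open>The factor is the determinant of the change of basis and therefore the same for all
  choices of columns.\<close>

lemma plucker_change_basis:
  assumes "is_basis bs V" "is_basis bs' V"
  shows "\<exists>c. \<forall>\<mu>. plucker bs' \<mu> = c * plucker bs \<mu>"
proof -
  define N where "N = length bs"
  have N': "length bs' = N" using is_basis_length[OF assms(1)] is_basis_length[OF assms(2)] by (simp add: N_def)
  have "\<exists>u. \<forall>m. lookup (bs' ! i) m = (\<Sum>j<N. u j * lookup (bs ! j) m)" if "i < N" for i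
  proof -
    have "bs' ! i \<in> cpoly.span (set bs')" using that N' by (intro cpoly.span_base) simp
    also have "cpoly.span (set bs') = cpoly.span (set bs)" using assms by (simp add: is_basis_def)
    finally obtain u where "bs' ! i = (\<Sum>v\<in>set bs. cscale (u v) v)"
      by (auto simp: cpoly.span_finite)
    also have "\<dots> = (\<Sum>j<N. cscale (u (bs ! j)) (bs ! j))"
      using assms(1) unfolding N_def is_basis_def
      by (intro sum.reindex_bij_betw[symmetric] bij_betw_nth) auto
    finally show ?thesis
      by (intro exI[of _ "\<lambda>j. u (bs ! j)"]) (simp add: lookup_sum)
  qed
  then obtain P where P: "\<And>i m. i < N \<Longrightarrow> lookup (bs' ! i) m = (\<Sum>j<N. P i j * lookup (bs ! j) m)"
    by metis
  define M where "M = mat N N (\<lambda>(i, j). P i j)"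
  have M: "M \<in> carrier_mat N N" by (simp add: M_def)
  have "plucker bs' \<mu> = det M * plucker bs \<mu>" for \<mu>
  proof -
    let ?A = "mat N N (\<lambda>(i, j). lookup (bs ! i) (\<mu> j))"
    have "mat N N (\<lambda>(i, j). lookup (bs' ! i) (\<mu> j)) = M * ?A"
      by (rule eq_matI) (auto simp: M_def P scalar_prod_def lessThan_atLeast0)
    then show ?thesis
      unfolding plucker_def N' N_def[symmetric] using det_mult[OF M, of ?A] by simp
  qed
  then show ?thesis by blast
qed

lemma multihomogeneous_scale:
  assumes "multihomogeneous f" "\<And>k \<mu>. a' (k, \<mu>) = c k * a (k, \<mu>)"
  shows "\<exists>C. poly_eval a' f = C * poly_eval a f"
proof -
  obtain e where e: "\<And>m k. m \<in> keys f \<Longrightarrow> (\<Sum>x\<in>{x \<in> keys m. fst x = k}. lookup m x) = e k"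
    using assms(1) by (auto simp: multihomogeneous_def)
  \<comment> \<open>Any monomial of \<open>f\<close> bounds the support of \<open>e\<close>, so the
    product is finite when \<open>f\<close> is nonzero; for \<open>f = 0\<close> every constant will
    do.\<close>
  define C where "C = (\<Prod>k\<in>{k. e k \<noteq> 0}. c k ^ e k)"
  have "mono_eval a' m = C * mono_eval a m" if m: "m \<in> keys f" for m
  proof -
    have "{k. e k \<noteq> 0} \<subseteq> fst ` keys m"
    proof
      fix k assume "k \<in> {k. e k \<noteq> 0}"
      then have "(\<Sum>x\<in>{x \<in> keys m. fst x = k}. lookup m x) \<noteq> 0" using e[OF m] by simp
      then have "{x \<in> keys m. fst x = k} \<noteq> {}" by (metis sum.empty)
      then obtain x where "x \<in> keys m" "fst x = k" by blast
      then show "k \<in> fst ` keys m" by (metis imageI)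
    qed
    then have "C = (\<Prod>k\<in>fst ` keys m. c k ^ e k)"
      unfolding C_def by (intro prod.mono_neutral_left) auto
    also have "\<dots> = (\<Prod>k\<in>fst ` keys m. \<Prod>x\<in>{x \<in> keys m. fst x = k}. c (fst x) ^ lookup m x)"
      by (intro prod.cong) (auto simp: e[OF m, symmetric] power_sum)
    also have "\<dots> = (\<Prod>x\<in>keys m. c (fst x) ^ lookup m x)"
      by (rule prod.image_gen[symmetric]) simp
    finally have C: "C = (\<Prod>x\<in>keys m. c (fst x) ^ lookup m x)" .
    have "a' x = c (fst x) * a x" for x using assms(2)[of "fst x" "snd x"] by simp
    then show ?thesis
      unfolding C mono_eval_def by (simp add: power_mult_distrib prod.distrib)
  qed
  then have "poly_eval a' f = C * poly_eval a f"
    unfolding poly_eval_superset[OF finite_keys order_refl] sum_distrib_left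
    by (intro sum.cong) auto
  then show ?thesis ..
qed

lemma hilb_zariski_topspace: "topspace (hilb_zariski r) \<subseteq> hilb r"
  unfolding hilb_zariski_def topology_generated_by_topspace by blast

lemma slip_subset_hilb: "slip r \<subseteq> hilb r"
  unfolding slip_def using closure_of_subset_topspace hilb_zariski_topspace by (rule subset_trans)


section \<open>Limits of ideals of points\<close>

context catalecticant
begin

text \<open>The order of the basis is fixed independently of F, so that its Pluecker coordinates are
  regular functions of F.\<close>

definition pivot_list :: "nat \<Rightarrow> 'v monom list" where
  "pivot_list k = (SOME xs. set xs = pivots k \<and> distinct xs)"

lemma pivot_list: "set (pivot_list k) = pivots k" "distinct (pivot_list k)"
  using someI_ex[OF finite_distinct_list[OF finite_pivots[of k]]] by (auto simp: pivot_list_def)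

definition basis_list :: "nat \<Rightarrow> 'v cpoly \<Rightarrow> 'v cpoly list" where
  "basis_list k F = map (generator k F) (pivot_list k)"

lemma is_basis_basis_list:
  assumes "disc F \<noteq> 0"
  shows "is_basis (basis_list k F) (apolar_ideal F \<inter> forms k)"
proof -
  interpret echelon_family "pivots k" "generator k F" "disc F ^ (k - s)"
    by (rule echelon_generators[OF assms])
  show ?thesis
    using inj_w independent_w
    by (simp add: is_basis_def basis_list_def distinct_map pivot_list apolar_ideal_Int_forms ideal_part_def)
qed

lemma regular_plucker: "regular (\<lambda>F. plucker (basis_list k F) \<mu>)"
proof -
  have "plucker (basis_list k F) \<mu> = det (mat (length (pivot_list k)) (length (pivot_list k))
      (\<lambda>(i, j). lookup (generator k F (pivot_list k ! i)) (\<mu> j)))" for F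
    unfolding plucker_def basis_list_def length_map
    by (intro arg_cong[of _ _ det] eq_matI) auto
  note eq = this
  have "pivot_list k ! i \<in> pivots k" if "i < length (pivot_list k)" for i
    using nth_mem[OF that] by (simp add: pivot_list)
  then show ?thesis
    unfolding eq by (intro regular_det regular_generator)
qed

text \<open>For nondegenerate power sums the spans form the ideal of the points, so all obstructions
  vanish there; by density they vanish at F.\<close>

lemma homogeneous_apolar_ideal_secant:
  assumes "pt F \<in> secant_variety r (2 * s + 1)" "disc F \<noteq> 0"
  shows "homogeneous_ideal (apolar_ideal F)"
proof (rule homogeneous_apolar_ideal)
  fix i k m assume m: "m \<in> pivots k"
  have "lookup (obstruction i k m F) n = 0" for n
  proof (rule ccontr)
    assume "lookup (obstruction i k m F) n \<noteq> 0"
    \<comment> \<open>The extra factor forces the power sum supplied by density to be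
      nondegenerate.\<close>
    then have ne: "disc F * lookup (obstruction i k m F) n \<noteq> 0" using assms(2) by simp
    have reg: "regular (\<lambda>F. disc F * lookup (obstruction i k m F) n)"
      by (intro regular_mult regular_disc regular_obstruction[OF m])
    obtain c l where cl: "\<forall>j. l j \<in> forms 1"
      "disc (power_sum_form (2 * s + 1) r c l)
         * lookup (obstruction i k m (power_sum_form (2 * s + 1) r c l)) n \<noteq> 0"
      using secant_variety_dense[OF assms(1) order_refl reg ne] by blast
    let ?G = "power_sum_form (2 * s + 1) r c l"
    have disc: "disc ?G \<noteq> 0" using cl(2) by auto
    have "homogeneous_ideal (apolar_ideal ?G)"
      using apolar_ideal_of_points[OF _ disc] cl(1) by (simp add: hilb_def)
    then have "module.subspace (*) (apolar_ideal ?G)" by (simp add: homogeneous_ideal_def)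
    moreover have "generator k ?G m \<in> ideal_part k ?G"
      unfolding ideal_part_def by (intro cpoly.span_base imageI m)
    then have "generator k ?G m \<in> apolar_ideal ?G"
      unfolding apolar_ideal_Int_forms[symmetric] by blast
    ultimately have "single (single i 1) 1 * generator k ?G m \<in> apolar_ideal ?G"
      by (simp add: ideal_iff)
    moreover have "single (single i 1) 1 * generator k ?G m \<in> forms (Suc k)"
      using forms_mult[OF forms_single[of "single i 1" 1 1] generator_in_forms[OF m]] by simp
    ultimately have "single (single i 1) 1 * generator k ?G m \<in> ideal_part (Suc k) ?G"
      unfolding apolar_ideal_Int_forms[symmetric] by (rule IntI)
    then have "obstruction i k m ?G = 0" by (rule obstruction_eq_0_iff[OF disc, THEN iffD2])
    then show False using cl(2) by simp
  qed
  then have "obstruction i k m F = 0" by (intro poly_mapping_eqI) simp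
  then show "single (single i 1) 1 * generator k F m \<in> ideal_part (Suc k) F"
    by (rule obstruction_eq_0_iff[OF assms(2), THEN iffD1])
qed

text \<open>Continuity of the map from F to \<open>apolar_ideal F\<close> on the nondegenerate forms
  for which it takes values in the Hilbert scheme.\<close>

lemma apolar_ideal_neighbourhood:
  assumes "openin (hilb_zariski r) T" "disc F \<noteq> 0" "apolar_ideal F \<in> T"
  shows "\<exists>g. regular g \<and> g F \<noteq> 0 \<and>
    (\<forall>G. (disc G \<noteq> 0 \<and> apolar_ideal G \<in> hilb r) \<and> g G \<noteq> 0 \<longrightarrow> apolar_ideal G \<in> T)"
proof (rule generated_topology_neighbourhood[OF assms(1)[unfolded hilb_zariski_def]])
  fix B assume "B \<in> {{I \<in> hilb r. \<exists>b. (\<forall>k. is_basis (b k) (I \<inter> forms k)) \<and>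
      poly_eval (\<lambda>(k, \<mu>). plucker (b k) \<mu>) f \<noteq> 0} |f. multihomogeneous f}"
    and FB: "apolar_ideal F \<in> B"
  then obtain f where f: "multihomogeneous f"
    and B: "B = {I \<in> hilb r. \<exists>b. (\<forall>k. is_basis (b k) (I \<inter> forms k)) \<and>
      poly_eval (\<lambda>(k, \<mu>). plucker (b k) \<mu>) f \<noteq> 0}" by blast
  obtain b where b: "\<And>k. is_basis (b k) (apolar_ideal F \<inter> forms k)"
    "poly_eval (\<lambda>(k, \<mu>). plucker (b k) \<mu>) f \<noteq> 0" using FB unfolding B by blast
  let ?g = "\<lambda>F. poly_eval (\<lambda>(k, \<mu>). plucker (basis_list k F) \<mu>) f"
  \<comment> \<open>The open set is witnessed by arbitrary bases \<open>b\<close>, whereas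
    regularity is known for \<open>basis_list\<close>. Multihomogeneity of \<open>f\<close>
    transfers the non-vanishing from the former to the latter.\<close>
  have "\<exists>c. \<forall>\<mu>. plucker (b k) \<mu> = c * plucker (basis_list k F) \<mu>" for k
    by (rule plucker_change_basis[OF is_basis_basis_list[OF assms(2)] b(1)])
  then obtain c where "\<And>k \<mu>. plucker (b k) \<mu> = c k * plucker (basis_list k F) \<mu>" by metis
  then obtain C where "poly_eval (\<lambda>(k, \<mu>). plucker (b k) \<mu>) f = C * ?g F"
    using multihomogeneous_scale[OF f, of "\<lambda>(k, \<mu>). plucker (b k) \<mu>" c
        "\<lambda>(k, \<mu>). plucker (basis_list k F) \<mu>"] by auto
  then have "?g F \<noteq> 0" using b(2) by auto
  moreover have "regular ?g"
    by (rule regular_poly_eval) (auto intro: regular_plucker)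
  moreover have "apolar_ideal G \<in> B" if "disc G \<noteq> 0" "apolar_ideal G \<in> hilb r" "?g G \<noteq> 0" for G
    unfolding B using that is_basis_basis_list[OF that(1)] by (intro CollectI conjI exI[of _ "\<lambda>k. basis_list k G"]) auto
  ultimately show "\<exists>g. regular g \<and> g F \<noteq> 0 \<and>
      (\<forall>G. (disc G \<noteq> 0 \<and> apolar_ideal G \<in> hilb r) \<and> g G \<noteq> 0 \<longrightarrow> apolar_ideal G \<in> B)"
    by (intro exI[of _ ?g]) auto
qed (use assms in auto)

text \<open>Continuity pulls a neighbourhood of the ideal back to a neighbourhood of F, and density
  finds a nondegenerate power sum there, whose ideal is one of r distinct points.\<close>

lemma apolar_ideal_in_slip:
  assumes "pt F \<in> secant_variety r (2 * s + 1)" "disc F \<noteq> 0"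
  shows "apolar_ideal F \<in> slip r"
  unfolding slip_def in_closure_of
proof (intro conjI allI impI)
  have hilb: "apolar_ideal F \<in> hilb r"
    by (rule apolar_ideal_in_hilb[OF assms(2) homogeneous_apolar_ideal_secant[OF assms]])
  \<comment> \<open>The basic open set of the constant equation 1, used to see that the ideal lies
    in the underlying space of the generated topology.\<close>
  let ?B = "{I \<in> hilb r. \<exists>b. (\<forall>k. is_basis (b k) (I \<inter> forms k)) \<and>
      poly_eval (\<lambda>(k, \<mu>). plucker (b k) \<mu>) (1 :: (nat \<times> (nat \<Rightarrow> 'v monom)) cpoly) \<noteq> 0}"
  have "multihomogeneous (1 :: (nat \<times> (nat \<Rightarrow> 'v monom)) cpoly)"
    unfolding multihomogeneous_def by (intro exI[of _ "\<lambda>_. 0"]) simp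
  then have "openin (hilb_zariski r) ?B"
    unfolding hilb_zariski_def by (intro topology_generated_by_Basis) blast
  moreover have "apolar_ideal F \<in> ?B"
    using hilb is_basis_basis_list[OF assms(2)] by (intro CollectI conjI exI[of _ "\<lambda>k. basis_list k F"]) auto
  ultimately show "apolar_ideal F \<in> topspace (hilb_zariski r)"
    by (meson openin_subset subsetD)
next
  fix T assume T: "apolar_ideal F \<in> T \<and> openin (hilb_zariski r) T"
  then obtain g where g: "regular g" "g F \<noteq> 0"
    "\<And>G. disc G \<noteq> 0 \<Longrightarrow> apolar_ideal G \<in> hilb r \<Longrightarrow> g G \<noteq> 0 \<Longrightarrow> apolar_ideal G \<in> T"
    using apolar_ideal_neighbourhood[of T F] assms(2) by auto
  have reg: "regular (\<lambda>F. disc F * g F)" by (intro regular_mult regular_disc g(1))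
  have ne: "disc F * g F \<noteq> 0" using assms(2) g(2) by simp
  obtain c l where cl: "\<forall>j. l j \<in> forms 1"
    "disc (power_sum_form (2 * s + 1) r c l) * g (power_sum_form (2 * s + 1) r c l) \<noteq> 0"
    using secant_variety_dense[OF assms(1) order_refl reg ne] by blast
  let ?G = "power_sum_form (2 * s + 1) r c l"
  have disc: "disc ?G \<noteq> 0" "g ?G \<noteq> 0" using cl(2) by auto
  have points: "apolar_ideal ?G
      \<in> {I \<in> hilb r. \<exists>\<Gamma> \<subseteq> proj_forms 1. finite \<Gamma> \<and> card \<Gamma> = r \<and> I = vanishing_ideal \<Gamma>}"
    by (rule apolar_ideal_of_points[OF _ disc(1)]) (use cl(1) in simp)
  then have "apolar_ideal ?G \<in> T" using g(3)[OF disc(1) _ disc(2)] by simp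
  with points show "\<exists>I. I \<in> {I \<in> hilb r. \<exists>\<Gamma> \<subseteq> proj_forms 1. finite \<Gamma> \<and> card \<Gamma> = r
      \<and> I = vanishing_ideal \<Gamma>} \<and> I \<in> T" by (intro exI conjI)
qed

text \<open>The discriminant of a power sum contains every \<open>c j\<close> as a factor, so it
  vanishes on sums of fewer than r powers and hence on the smaller secant varieties.\<close>

lemma border_rank_eq:
  assumes "pt F \<in> secant_variety r (2 * s + 1)" "disc F \<noteq> 0"
  shows "border_rank (2 * s + 1) F = r"
  unfolding border_rank_def
proof (rule Least_equality)
  fix k assume k: "pt F \<in> secant_variety k (2 * s + 1)"
  show "r \<le> k"
  proof (rule ccontr)
    assume "\<not> r \<le> k"
    then have "k \<le> r" "k < r" by auto
    obtain c l where cl: "\<forall>j. l j \<in> forms 1" "\<forall>j\<ge>k. c j = 0"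
      "disc (power_sum_form (2 * s + 1) r c l) \<noteq> 0"
      using secant_variety_dense[OF k \<open>k \<le> r\<close> regular_disc assms(2)] by blast
    have "\<forall>j<r. c j \<noteq> 0 \<and> z_coord (l j) \<noteq> 0"
      using iffD1[OF disc_power_sum_form cl(3)] cl(1) by simp
    then show False using cl(2) \<open>k < r\<close> by blast
  qed
qed (rule assms(1))

lemma border_identifiable_disc:
  assumes "pt F \<in> secant_variety r (2 * s + 1)" "disc F \<noteq> 0"
  shows "border_identifiable (2 * s + 1) F"
proof -
  have F: "F \<in> forms (2 * s + 1)"
    using assms(1) secant_variety_subset proj_forms_ptD by (metis DiffD1 subsetD)
  have "border_vsp F r = {apolar_ideal F}"
  proof (intro equalityI subsetI)
    fix J assume "J \<in> border_vsp F r"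
    then have "J \<in> hilb r" "J \<subseteq> Ann F" using slip_subset_hilb by (auto simp: border_vsp_def)
    then show "J \<in> {apolar_ideal F}" using hilb_subset_Ann_unique[OF F assms(2)] by simp
  qed (use apolar_ideal_in_slip[OF assms] apolar_ideal_subset_Ann[OF F] in \<open>auto simp: border_vsp_def\<close>)
  then show ?thesis
    unfolding border_identifiable_def border_rank_eq[OF assms] by simp
qed


section \<open>Forms with nonzero discriminant are dense\<close>

text \<open>Makes non-vanishing of the discriminant a property of the point \<open>pt F\<close>,
  independent of its representative.\<close>

lemma disc_cscale: "disc (cscale t F) = t ^ r * disc F"
proof -
  have "catal (cscale t F) = t \<cdot>\<^sub>m catal F"
    by (rule eq_matI) (simp_all add: catal_def pairing_cscale_left del: pairing_single)
  then show ?thesis by (simp add: disc_def catal_def)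
qed

text \<open>
  The points with \<open>z\<close>-coordinate 1 whose other coordinates are those of an exponent vector of
  degree \<open>s\<close> form a principal lattice, on which interpolation by forms of degree \<open>s\<close> is
  solved by products of linear forms.
\<close>

definition lattice_point :: "'v monom \<Rightarrow> 'v cpoly" where
  "lattice_point \<mu> = (\<Sum>i\<in>UNIV. single (single i 1) (if i = z then 1 else of_nat (lookup \<mu> i)))"

lemma lattice_point_in_forms: "lattice_point \<mu> \<in> forms 1"
  unfolding lattice_point_def by (intro cpoly.subspace_sum[OF forms_subspace] forms_single) simp

lemma lookup_lattice_point:
  "lookup (lattice_point \<mu>) (single i 1) = (if i = z then 1 else of_nat (lookup \<mu> i))"
proof -
  have "single i (1::nat) = single k 1 \<longleftrightarrow> i = k" for i k :: 'v
    by (auto dest: arg_cong[of _ _ keys])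
  then show ?thesis by (simp add: lattice_point_def lookup_sum lookup_single when_def)
qed

text \<open>The Lagrange form of the lattice point of \<nu>, up to a scalar. The coordinate z is
  spent on homogenising, so the missing exponent of z is recovered as s minus the sum of the others;
  at the point of \<mu> the factors become falling factorials.\<close>

definition lattice_form :: "'v monom \<Rightarrow> 'v cpoly" where
  "lattice_form \<nu> = (\<Prod>i\<in>UNIV. \<Prod>t<lookup \<nu> i.
     (if i = z then cscale (of_nat s) (z_power 1) - (\<Sum>k\<in>UNIV - {z}. single (single k 1) 1)
      else single (single i 1) 1) - cscale (of_nat t) (z_power 1))"

lemma lattice_form_in_forms: "lattice_form \<nu> \<in> forms (mdeg \<nu>)"
proof -
  have "lattice_form \<nu> \<in> forms (\<Sum>i\<in>UNIV. \<Sum>t<lookup \<nu> i. 1)"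
    unfolding lattice_form_def
    by (intro forms_prod cpoly.subspace_diff[OF forms_subspace] cpoly.subspace_scale[OF forms_subspace])
      (auto intro!: forms_single cpoly.subspace_diff[OF forms_subspace]
        cpoly.subspace_scale[OF forms_subspace] cpoly.subspace_sum[OF forms_subspace] simp del: cscale_single)
  then show ?thesis by (simp add: mdeg_finite)
qed

lemma eval_lattice_form:
  assumes "mdeg \<mu> = s"
  shows "eval_at (lattice_point \<mu>) (lattice_form \<nu>)
    = (\<Prod>i\<in>UNIV. \<Prod>t<lookup \<nu> i. of_nat (lookup \<mu> i) - of_nat t)"
proof -
  let ?e = "poly_eval (\<lambda>i. lookup (lattice_point \<mu>) (single i 1))"
  have "(\<Sum>k\<in>UNIV - {z}. lookup \<mu> k) + lookup \<mu> z = s"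
    using assms unfolding mdeg_finite by (simp add: sum.remove[of UNIV z])
  then have "of_nat s - (\<Sum>k\<in>UNIV - {z}. of_nat (lookup \<mu> k)) = (of_nat (lookup \<mu> z) :: complex)"
    by (metis add_diff_cancel_left' of_nat_add of_nat_sum)
  moreover have "(\<Sum>k\<in>UNIV - {z}. if k = z then 1 else of_nat (lookup \<mu> k))
      = (\<Sum>k\<in>UNIV - {z}. of_nat (lookup \<mu> k) :: complex)"
    by (intro sum.cong) auto
  ultimately show ?thesis
    unfolding eval_at_def lattice_form_def poly_eval_prod
    by (intro prod.cong refl)
      (auto simp: poly_eval_diff poly_eval_sum poly_eval_cscale lookup_lattice_point[simplified]
        simp del: cscale_single)
qed

text \<open>A factor vanishes exactly when some exponent of \<mu> is smaller than that of \<nu>; for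
  equal degrees this happens unless the two coincide.\<close>

lemma eval_lattice_form_eq_0_iff:
  assumes "mdeg \<mu> = s" "mdeg \<nu> = s"
  shows "eval_at (lattice_point \<mu>) (lattice_form \<nu>) = 0 \<longleftrightarrow> \<mu> \<noteq> \<nu>"
proof -
  have "eval_at (lattice_point \<mu>) (lattice_form \<nu>) = 0 \<longleftrightarrow> (\<exists>i. lookup \<mu> i < lookup \<nu> i)"
    unfolding eval_lattice_form[OF assms(1)] by auto
  moreover have "\<mu> = \<nu>" if "\<forall>i. lookup \<nu> i \<le> lookup \<mu> i"
  proof (rule poly_mapping_eqI, rule ccontr)
    fix i assume "lookup \<mu> i \<noteq> lookup \<nu> i"
    then have "lookup \<nu> i < lookup \<mu> i" using that by (simp add: le_neq_implies_less)
    then have "mdeg \<nu> < mdeg \<mu>"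
      unfolding mdeg_finite using that by (intro sum_strict_mono_ex1) auto
    then show False using assms by simp
  qed
  ultimately show ?thesis by (metis linorder_not_less order_less_irrefl)
qed

lemma det_vander_lattice: "det (vander (\<lambda>j. lattice_point (ms ! j))) \<noteq> 0"
proof
  let ?l = "\<lambda>j. lattice_point (ms ! j)"
  assume "det (vander ?l) = 0"
  then have "det (transpose_mat (vander ?l)) = 0" by (simp add: det_transpose[OF vander_carrier])
  moreover have carrier: "transpose_mat (vander ?l) \<in> carrier_mat r r" by (simp add: vander_def)
  ultimately obtain v where v: "v \<in> carrier_vec r" "v \<noteq> 0\<^sub>v r" "transpose_mat (vander ?l) *\<^sub>v v = 0\<^sub>v r"
    unfolding det_0_iff_vec_prod_zero[OF carrier] by blast
  have mono: "(\<Sum>j<r. v $ j * eval_at (?l j) (single (ms ! i) 1)) = 0" if i: "i < r" for i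
  proof -
    have "(transpose_mat (vander ?l) *\<^sub>v v) $ i = (\<Sum>j<r. v $ j * eval_at (?l j) (single (ms ! i) 1))"
      using i v(1) by (simp add: vander_def scalar_prod_def lessThan_atLeast0 mult.commute)
    then show ?thesis using v(3) i by simp
  qed
  \<comment> \<open>By linearity, a dependence between the rows extends from monomials to all forms
    of degree s. Testing it on the Lagrange form of one point isolates a single entry of
    \<open>v\<close>.\<close>
  have all: "(\<Sum>j<r. v $ j * eval_at (?l j) q) = 0" if q: "q \<in> forms s" for q
  proof -
    have "eval_at (?l j) q = (\<Sum>i<r. lookup q (ms ! i) * eval_at (?l j) (single (ms ! i) 1))" for j
      by (subst forms_expansion[OF q]) (simp add: eval_at_def poly_eval_sum poly_eval_cscale del: cscale_single)
    then have "(\<Sum>j<r. v $ j * eval_at (?l j) q)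
        = (\<Sum>j<r. \<Sum>i<r. lookup q (ms ! i) * (v $ j * eval_at (?l j) (single (ms ! i) 1)))"
      by (simp add: sum_distrib_left mult.left_commute)
    also have "\<dots> = (\<Sum>i<r. lookup q (ms ! i) * (\<Sum>j<r. v $ j * eval_at (?l j) (single (ms ! i) 1)))"
      unfolding sum_distrib_left by (rule sum.swap)
    also have "\<dots> = 0" using mono by simp
    finally show ?thesis .
  qed
  have "v $ b = 0" if b: "b < r" for b
  proof -
    let ?L = "lattice_form (ms ! b)"
    have "?L \<in> forms s" using lattice_form_in_forms[of "ms ! b"] mdeg_ms[OF b] by simp
    then have "0 = (\<Sum>j<r. v $ j * eval_at (?l j) ?L)" using all by simp
    also have "\<dots> = (\<Sum>j<r. if j = b then v $ j * eval_at (?l j) ?L else 0)"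
      using eval_lattice_form_eq_0_iff[OF mdeg_ms mdeg_ms[OF b]] nth_eq_iff_index_eq[OF distinct_ms _ b]
      by (intro sum.cong) auto
    also have "\<dots> = v $ b * eval_at (?l b) ?L" using b by simp
    finally show ?thesis using eval_lattice_form_eq_0_iff[OF mdeg_ms[OF b] mdeg_ms[OF b]] by simp
  qed
  then have "v = 0\<^sub>v r" using v(1) by (intro eq_vecI) auto
  then show False using v(2) by simp
qed

lemma disc_lattice: "disc (power_sum_form (2 * s + 1) r (\<lambda>_. 1) (\<lambda>j. lattice_point (ms ! j))) \<noteq> 0"
proof (rule iffD2[OF disc_power_sum_form[OF lattice_point_in_forms]])
  show "det (vander (\<lambda>j. lattice_point (ms ! j))) \<noteq> 0
    \<and> (\<forall>j<r. (1::complex) \<noteq> 0 \<and> z_coord (lattice_point (ms ! j)) \<noteq> 0)"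
    using det_vander_lattice by (simp only: lookup_lattice_point) simp
qed

text \<open>The coefficients and linear forms of a given power sum are joined by a line to those of
  the lattice configuration. Neither \<open>g\<close> nor the discriminant vanishes identically
  along it, so some parameter avoids the zeros of both.\<close>

lemma spanned_points_dense:
  assumes "p \<in> spanned_points r (2 * s + 1)" "openin (proj_zariski (2 * s + 1)) T" "p \<in> T"
  shows "\<exists>F. F \<in> forms (2 * s + 1) - {0} \<and> disc F \<noteq> 0 \<and> pt F \<in> T \<and> pt F \<in> secant_variety r (2 * s + 1)"
proof -
  let ?d = "2 * s + 1"
  obtain F where F: "F \<in> forms ?d - {0}" "p = pt F"
    using assms(1) by (auto simp: spanned_points_def proj_forms_def)
  obtain g where g: "regular g" "g F \<noteq> 0" "\<And>G. G \<in> forms ?d - {0} \<Longrightarrow> g G \<noteq> 0 \<Longrightarrow> pt G \<in> T"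
    using proj_zariski_neighbourhood[OF assms(2) F(1)] assms(3) F(2) by auto
  obtain c l where cl: "F = power_sum_form ?d r c l" "\<forall>j. l j \<in> forms 1"
    using spanned_points_power_sum[OF assms(1)[unfolded F(2)] order_refl] by metis
  define c' where "c' t j = (1 - t) * c j + t" for t j
  define l' where "l' t j = cscale (1 - t) (l j) + cscale t (lattice_point (ms ! j))" for t j
  define G where "G t = power_sum_form ?d r (c' t) (l' t)" for t
  have l': "l' t j \<in> forms 1" for t j
    unfolding l'_def using cl(2)
    by (intro cpoly.subspace_add[OF forms_subspace] cpoly.subspace_scale[OF forms_subspace]
        lattice_point_in_forms) auto
  have line: "polyfun (\<lambda>t. (1 - t) * a + t * b)" for a b
    unfolding polyfun_def by (rule exI[of _ "[:a, b - a:]"]) (simp add: algebra_simps)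
  have poly: "polyfun (\<lambda>t. lookup (G t) m)" for m
    unfolding G_def
  proof (rule polyfun_lookup_power_sum_form[OF l'])
    show "polyfun (\<lambda>t. c' t j)" for j using line[of "c j" 1] by (simp add: c'_def)
    show "polyfun (\<lambda>t. lookup (l' t j) m)" for j m
      using line by (simp add: l'_def lookup_add)
  qed
  have "c' 0 = c" "l' 0 = l" "c' 1 = (\<lambda>_. 1)" "l' 1 = (\<lambda>j. lattice_point (ms ! j))"
    by (auto simp: c'_def l'_def)
  note ends = this
  have "G 0 = F" by (simp only: G_def cl(1) ends)
  then have g0: "g (G 0) \<noteq> 0" using g(2) by simp
  have "G 1 = power_sum_form ?d r (\<lambda>_. 1) (\<lambda>j. lattice_point (ms ! j))"
    by (simp only: G_def ends)
  then have d1: "disc (G 1) \<noteq> 0" using disc_lattice by simp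
  \<comment> \<open>The zeros of the discriminant along the line are finitely many; they are the
    exceptional set handed to \<open>polyfun_nonzero\<close> for \<open>g\<close>.\<close>
  obtain P where P: "\<And>t. disc (G t) = poly P t"
    using polyfun_regular[OF regular_disc poly] by (auto simp: polyfun_def)
  then have "P \<noteq> 0" using d1 by auto
  then have "finite {t. poly P t = 0}" by (rule poly_roots_finite)
  then obtain t where t: "poly P t \<noteq> 0" "g (G t) \<noteq> 0"
    using polyfun_nonzero[OF polyfun_regular[OF g(1) poly] g0] by blast
  have disc: "disc (G t) \<noteq> 0" using t(1) P by simp
  then have nz: "G t \<noteq> 0" by auto
  have Gf: "G t \<in> forms ?d - {0}"
    using power_sum_form_in_forms[of r "l' t" ?d "c' t"] l' nz by (simp add: G_def)
  have "pt (G t) \<in> spanned_points r ?d"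
    using power_sum_in_spanned_points[of r "l' t" ?d "c' t"] l' nz by (simp add: G_def)
  moreover have "spanned_points r ?d \<subseteq> secant_variety r ?d"
    unfolding secant_variety_eq
    by (rule closure_of_subset) (auto simp: topspace_proj_zariski spanned_points_def)
  ultimately show ?thesis using Gf disc g(3)[OF Gf t(2)] by blast
qed

lemma holds_generally_border_identifiable:
  "holds_generally (proj_zariski (2 * s + 1)) (secant_variety r (2 * s + 1) :: 'v cpoly set set)
     (\<lambda>p. \<forall>F. p = pt F \<longrightarrow> border_identifiable (2 * s + 1) F)"
proof -
  let ?d = "2 * s + 1"
  let ?X = "proj_zariski ?d :: 'v cpoly set topology"
  let ?V = "secant_variety r ?d :: 'v cpoly set set"
  let ?D = "pt ` {F \<in> forms ?d - {0}. disc F \<noteq> 0}"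
  have open_U: "openin (subtopology ?X ?V) (?D \<inter> ?V)"
    by (intro openin_subtopology_Int openin_regular_nonzero regular_disc)
  have dense: "subtopology ?X ?V closure_of (?D \<inter> ?V) = ?V"
  proof -
    have "spanned_points r ?d \<subseteq> ?X closure_of (?D \<inter> ?V)"
    proof
      fix p assume p: "p \<in> (spanned_points r ?d :: 'v cpoly set set)"
      show "p \<in> ?X closure_of (?D \<inter> ?V)"
        unfolding in_closure_of
      proof (intro conjI allI impI)
        show "p \<in> topspace ?X" using p by (simp add: topspace_proj_zariski spanned_points_def)
      next
        fix T assume "p \<in> T \<and> openin ?X T"
        then obtain F where "F \<in> forms ?d - {0}" "disc F \<noteq> 0" "pt F \<in> T" "pt F \<in> ?V"
          using spanned_points_dense[OF p] by metis
        then show "\<exists>q. q \<in> ?D \<inter> ?V \<and> q \<in> T" by (intro exI[of _ "pt F"]) auto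
      qed
    qed
    then have "?V \<subseteq> ?X closure_of (?D \<inter> ?V)"
      unfolding secant_variety_eq[of r ?d] by (intro closure_of_minimal) auto
    then show ?thesis by (auto simp: closure_of_subtopology Int_absorb1)
  qed
  have "border_identifiable ?d F" if "pt F \<in> ?D \<inter> ?V" for F
  proof -
    obtain G where G: "disc G \<noteq> 0" "pt F = pt G" using \<open>pt F \<in> ?D \<inter> ?V\<close> by auto
    have V: "pt F \<in> ?V" using that by (rule IntD2)
    then have "pt F \<in> proj_forms ?d" using secant_variety_subset by (rule subsetD[rotated])
    then have "F \<noteq> 0" using proj_forms_ptD by blast
    then obtain t where "t \<noteq> 0" "F = cscale t G" using pt_eqD[OF G(2)] by blast
    then have "disc F \<noteq> 0" using G(1) by (simp add: disc_cscale)
    then show ?thesis by (rule border_identifiable_disc[OF V])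
  qed
  then have good: "\<forall>p\<in>?D \<inter> ?V. \<forall>F. p = pt F \<longrightarrow> border_identifiable ?d F"
    by (intro ballI allI impI) (simp only:)
  show ?thesis
    unfolding holds_generally_def
    by (rule exI[of _ "?D \<inter> ?V"]) (rule conjI[OF open_U conjI[OF dense good]])
qed

end

theorem corollary6p4:
  fixes n s d r :: nat
  assumes "CARD('v::finite) = n + 1"
    and "n \<ge> 1"
    and "d = 2 * s + 1"
    and "r = (n + s) choose s"
  shows "holds_generally (proj_zariski d) (secant_variety r d :: 'v cpoly set set)
           (\<lambda>p. \<forall>F. p = pt F \<longrightarrow> border_identifiable d F)"
proof -
  obtain ms where ms: "set ms = (monomials s :: 'v monom set)" "distinct ms"
    using finite_distinct_list[OF finite_monomials] by blast
  \<comment> \<open>Any variable can serve as z, hence \<open>undefined\<close>.\<close>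
  interpret catalecticant undefined s ms by unfold_locales (use ms in auto)
  have "length ms = r" unfolding r_eq card_monomials[OF assms(1)] assms(4) ..
  then show ?thesis using holds_generally_border_identifiable assms(3) by simp
qed

end
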